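(* Let $(\Theta,\mathcal{B},\mu,\omega)$ be a measure-preserving dynamical system, let $X=[a,b]\subset\mathbb{R}$, and suppose that $(f_\beta)_{\beta\in[0,1]}$ is a parameter family of $\omega$-forced $C^2$-interval maps $f_\beta:\Theta\times X\to\Theta\times X$, $f_\beta(\theta,x)=(\omega(\theta),f_{\beta,\theta}(x))$. Assume that there exist measurable functions $\gamma^-,\gamma^+:\Theta\to X$ with $\gamma^-<\gamma^+$ such that, with $\Gamma_\theta=[\gamma^-(\theta),\gamma^+(\theta)]$ and $\Gamma=\{(\theta,x)\in\Theta\times X : x\in\Gamma_\theta\}$, the following hold (for $\mu$-a.e. $\theta\in\Theta$ and all $\beta\in[0,1]$ where applicable): (r1) there exist two $\mu$-uniformly separated $(f_0,\mu)$-invariant graphs in $\Gamma$, but no $(f_1,\mu)$-invariant graph in $\Gamma$; (r2) $f_{\beta,\theta}(\gamma^-(\theta))\ge\gamma^-(\omega(\theta))$ and $f_{\beta,\theta}(\gamma^+(\theta))\ge\gamma^+(\omega(\theta))$; (r3) the maps $(\beta,x)\mapsto f_{\beta,\theta}(x)$ and $(\beta,x)\mapsto f'_{\beta,\theta}(x)$ are continuous; (r4) the function $\eta(\theta)=\sup\{|\log f'_{\beta,\theta}(x)| : x\in\Gamma_\theta,\ \beta\in[0,1]\}$ is integrable with respect to $\mu$; (r5) $f'_{\beta,\theta}(x)>0$ for all $x\in\Gamma_\theta$; (r6) there exist constants $0<c_1\le C$ such that $c_1\le\partial_\beta f_{\beta,\theta}(x)\le C$ for all $x\in\Gamma_\theta$;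 (r7) there exists a constant $c_2>0$ such that $f''_{\beta,\theta}(x)>c_2$ for all $x\in\Gamma_\theta$. Then there exists a unique critical parameter $\beta_\mu\in(0,1)$ such that: (1) If $\beta<\beta_\mu$, then there exist exactly two $(f_\beta,\mu)$-invariant graphs $\varphi^-_\beta<\varphi^+_\beta$ in $\Gamma$, which are $\mu$-uniformly separated and satisfy $\lambda_\mu(\varphi^-_\beta)<0$ and $\lambda_\mu(\varphi^+_\beta)>0$. (2) If $\beta=\beta_\mu$, then either there exists exactly one $(f_\beta,\mu)$-invariant graph $\varphi_\beta$ in $\Gamma$, or there exist two $(f_\beta,\mu)$-invariant graphs $\varphi^-_\beta\le\varphi^+_\beta$ in $\Gamma$ which are measurably pinched. In the first case $\lambda_\mu(\varphi_\beta)=0$; in the second case $\lambda_\mu(\varphi^-_\beta)<0$ and $\lambda_\mu(\varphi^+_\beta)>0$. (3) If $\beta>\beta_\mu$, then there are no $(f_\beta,\mu)$-invariant graphs in $\Gamma$.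
   Context: A measure-preserving dynamical system $(\Theta,\mathcal{B},\mu,\omega)$ consists of a probability space $(\Theta,\mathcal{B},\mu)$ and a bimeasurable bijection $\omega:\Theta\to\Theta$ leaving $\mu$ invariant (no ergodicity is assumed). An $\omega$-forced $C^2$-interval map is a measurable skew-product map $f:\Theta\times X\to\Theta\times X$, $f(\theta,x)=(\omega(\theta),f_\theta(x))$, with $X=[a,b]$ a compact interval, such that all fibre maps $f_\theta:X\to X$ are $C^2$. Primes denote derivatives with respect to $x$. An $(f,\mu)$-invariant graph is a measurable function $\varphi:\Theta\to X$ with $f_\theta(\varphi(\theta))=\varphi(\omega(\theta))$ for $\mu$-a.e. $\theta$. Such graphs are considered as $\mu$-equivalence classes (functions equal $\mu$-a.e. are identified), and relations between them are understood $\mu$-a.e. It is contained in $\Gamma$ if $\varphi(\theta)\in\Gamma_\theta$ for $\mu$-a.e. $\theta$. The (vertical) Lyapunov exponent of an $(f_\beta,\mu)$-invariant graph $\varphi$ is $\lambda_\mu(\varphi)=\int_\Theta\log f'_{\beta,\theta}(\varphi(\theta))\,d\mu(\theta)$. Two measurable functions $\varphi^-\le\varphi^+:\Theta\to X$ are called measurably pinched if for every $\delta>0$ the set $\{\theta\in\Theta:\varphi^+(\theta)-\varphi^-(\theta)<\delta\}$ has positive $\mu$-measure. Otherwise they are called $\mu$-uniformly separated; equivalently, there is $\delta>0$ with $\varphi^-(\theta)\le\varphi^+(\theta)-\delta$ for $\mu$-a.e. $\theta$.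
   Formalization: In (1), "exactly two" fails without ergodicity, since graphs can be glued over invariant sets; it is read as: every invariant graph in Γ equals φ⁻ or φ⁺ at a.e. θ, and, when μ is ergodic, there are exactly two classes. *)

theory Defs
  imports "HOL-Probability.Probability"
begin

definition measure_preserving_system :: "'a measure \<Rightarrow> ('a \<Rightarrow> 'a) \<Rightarrow> bool" where
  "measure_preserving_system M \<omega> \<longleftrightarrow>
     prob_space M \<and>
     bij_betw \<omega> (space M) (space M) \<and>
     \<omega> \<in> measurable M M \<and>
     the_inv_into (space M) \<omega> \<in> measurable M M \<and>
     distr M M \<omega> = M"

definition ergodic :: "'a measure \<Rightarrow> ('a \<Rightarrow> 'a) \<Rightarrow> bool" where
  "ergodic M \<omega> \<longleftrightarrow>
     (\<forall>A\<in>sets M. \<omega> -` A \<inter> space M = A \<longrightarrow> measure M A = 0 \<or> measure M A = 1)"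

text \<open>Derivatives on a compact interval are one-sided at the end points, hence relative to the
  interval; the functions below carry no information outside it.\<close>

definition deriv_within :: "real set \<Rightarrow> (real \<Rightarrow> real) \<Rightarrow> real \<Rightarrow> real" where
  "deriv_within S g x = vector_derivative g (at x within S)"

definition C2_on :: "real set \<Rightarrow> (real \<Rightarrow> real) \<Rightarrow> bool" where
  "C2_on S g \<longleftrightarrow>
     (\<exists>g' g''. (\<forall>x\<in>S. (g has_real_derivative g' x) (at x within S)) \<and>
               (\<forall>x\<in>S. (g' has_real_derivative g'' x) (at x within S)) \<and>
               continuous_on S g'')"

text \<open>The skew product maps into \<open>\<Theta> \<times> X\<close>, so its measurability contains the
  condition that each fibre map \<open>g \<theta>\<close> is a self-map of \<open>X\<close>.\<close>

definition forced_C2_interval_map ::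
    "'a measure \<Rightarrow> ('a \<Rightarrow> 'a) \<Rightarrow> real set \<Rightarrow> ('a \<Rightarrow> real \<Rightarrow> real) \<Rightarrow> bool" where
  "forced_C2_interval_map M \<omega> X g \<longleftrightarrow>
     (\<lambda>(\<theta>, x). (\<omega> \<theta>, g \<theta> x)) \<in>
       measurable (M \<Otimes>\<^sub>M restrict_space borel X) (M \<Otimes>\<^sub>M restrict_space borel X) \<and>
     (\<forall>\<theta>\<in>space M. C2_on X (g \<theta>))"

definition invariant_graph ::
    "'a measure \<Rightarrow> ('a \<Rightarrow> 'a) \<Rightarrow> real set \<Rightarrow> ('a \<Rightarrow> real \<Rightarrow> real) \<Rightarrow> ('a \<Rightarrow> real) \<Rightarrow> bool" where
  "invariant_graph M \<omega> X g \<phi> \<longleftrightarrow>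
     \<phi> \<in> measurable M (restrict_space borel X) \<and>
     (AE \<theta> in M. g \<theta> (\<phi> \<theta>) = \<phi> (\<omega> \<theta>))"

text \<open>\<open>\<Gamma>\<close> is given by its fibres.\<close>

definition invariant_graph_in ::
    "'a measure \<Rightarrow> ('a \<Rightarrow> 'a) \<Rightarrow> real set \<Rightarrow> ('a \<Rightarrow> real \<Rightarrow> real) \<Rightarrow> ('a \<Rightarrow> real set)
      \<Rightarrow> ('a \<Rightarrow> real) \<Rightarrow> bool" where
  "invariant_graph_in M \<omega> X g \<Gamma> \<phi> \<longleftrightarrow>
     invariant_graph M \<omega> X g \<phi> \<and> (AE \<theta> in M. \<phi> \<theta> \<in> \<Gamma> \<theta>)"

definition lyapunov ::
    "'a measure \<Rightarrow> real set \<Rightarrow> ('a \<Rightarrow> real \<Rightarrow> real) \<Rightarrow> ('a \<Rightarrow> real) \<Rightarrow> real" where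
  "lyapunov M X g \<phi> = (\<integral>\<theta>. ln (deriv_within X (g \<theta>) (\<phi> \<theta>)) \<partial>M)"

definition measurably_pinched :: "'a measure \<Rightarrow> ('a \<Rightarrow> real) \<Rightarrow> ('a \<Rightarrow> real) \<Rightarrow> bool" where
  "measurably_pinched M \<phi>m \<phi>p \<longleftrightarrow>
     (AE \<theta> in M. \<phi>m \<theta> \<le> \<phi>p \<theta>) \<and>
     (\<forall>\<delta>>0. measure M {\<theta> \<in> space M. \<phi>p \<theta> - \<phi>m \<theta> < \<delta>} > 0)"

definition uniformly_separated :: "'a measure \<Rightarrow> ('a \<Rightarrow> real) \<Rightarrow> ('a \<Rightarrow> real) \<Rightarrow> bool" where
  "uniformly_separated M \<phi>m \<phi>p \<longleftrightarrow>
     (AE \<theta> in M. \<phi>m \<theta> \<le> \<phi>p \<theta>) \<and> \<not> measurably_pinched M \<phi>m \<phi>p"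

definition exactly_one_graph ::
    "'a measure \<Rightarrow> ('a \<Rightarrow> 'a) \<Rightarrow> real set \<Rightarrow> ('a \<Rightarrow> real \<Rightarrow> real) \<Rightarrow> ('a \<Rightarrow> real set)
      \<Rightarrow> ('a \<Rightarrow> real) \<Rightarrow> bool" where
  "exactly_one_graph M \<omega> X g \<Gamma> \<phi> \<longleftrightarrow>
     invariant_graph_in M \<omega> X g \<Gamma> \<phi> \<and>
     (\<forall>\<psi>. invariant_graph_in M \<omega> X g \<Gamma> \<psi> \<longrightarrow> (AE \<theta> in M. \<psi> \<theta> = \<phi> \<theta>))"

text \<open>``Exactly two invariant graphs \<open>\<phi>\<^sup>- < \<phi>\<^sup>+\<close> in \<open>\<Gamma>\<close>''. Without ergodicity, graphs
  can be glued: for an \<open>\<omega>\<close>-invariant set \<open>A\<close> with \<open>0 < \<mu>(A) < 1\<close> the function equal to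
  \<open>\<phi>\<^sup>-\<close> on \<open>A\<close> and to \<open>\<phi>\<^sup>+\<close> off \<open>A\<close> is again an invariant graph and is a.e. equal to neither.
  Hence the count is taken fibrewise: over a.e. \<open>\<theta>\<close> an invariant graph in \<open>\<Gamma>\<close> takes one of the
  two values \<open>\<phi>\<^sup>-(\<theta>), \<phi>\<^sup>+(\<theta>)\<close>. In particular \<open>(\<phi>\<^sup>-, \<phi>\<^sup>+)\<close> is, up to null sets, the only
  pair of invariant graphs in \<open>\<Gamma>\<close> which is strictly ordered a.e. When \<open>\<mu>\<close> is ergodic, there are
  exactly two equivalence classes.\<close>

definition exactly_two_graphs ::
    "'a measure \<Rightarrow> ('a \<Rightarrow> 'a) \<Rightarrow> real set \<Rightarrow> ('a \<Rightarrow> real \<Rightarrow> real) \<Rightarrow> ('a \<Rightarrow> real set)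
      \<Rightarrow> ('a \<Rightarrow> real) \<Rightarrow> ('a \<Rightarrow> real) \<Rightarrow> bool" where
  "exactly_two_graphs M \<omega> X g \<Gamma> \<phi>m \<phi>p \<longleftrightarrow>
     invariant_graph_in M \<omega> X g \<Gamma> \<phi>m \<and>
     invariant_graph_in M \<omega> X g \<Gamma> \<phi>p \<and>
     (AE \<theta> in M. \<phi>m \<theta> < \<phi>p \<theta>) \<and>
     (\<forall>\<psi>. invariant_graph_in M \<omega> X g \<Gamma> \<psi> \<longrightarrow>
        (AE \<theta> in M. \<psi> \<theta> = \<phi>m \<theta> \<or> \<psi> \<theta> = \<phi>p \<theta>) \<and>
        (ergodic M \<omega> \<longrightarrow>
           (AE \<theta> in M. \<psi> \<theta> = \<phi>m \<theta>) \<or> (AE \<theta> in M. \<psi> \<theta> = \<phi>p \<theta>)))"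

end

theory Submission
  imports Defs
begin

text \<open>
  Call a section \<open>\<psi>\<close> of \<open>\<Gamma>\<close> subinvariant for \<open>\<beta>\<close> if \<open>f\<^sub>\<beta>(\<psi>) \<le> \<psi> \<circ> \<omega>\<close> almost everywhere. Invariant
  graphs are subinvariant, and subinvariant sections are the more robust notion: they are stable under
  pointwise maxima, minima and limits, and, since \<open>f\<^sub>\<beta>\<close> increases with \<open>\<beta>\<close>, they stay subinvariant
  when \<open>\<beta>\<close> decreases.

  If there is a subinvariant section at all, an exhaustion argument (\<open>ae_greatest_element\<close>) yields an
  a.e. greatest and an a.e. least one. These are invariant graphs. The least one cannot be lowered by
  the graph transform, because \<open>\<gamma>\<^sup>-\<close> is a barrier for it. The greatest one cannot be raised by a
  fraction of its defect \<open>\<psi> \<circ> \<omega> - f\<^sub>\<beta>(\<psi>)\<close>; here \<open>exp \<eta>\<close> serves as a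
  fibrewise Lipschitz constant, which takes the place of the inverse graph transform. So the existence
  of an invariant graph at \<open>\<beta>\<close> amounts to the existence of a subinvariant section, and the parameters for which
  there is one form an interval containing \<open>0\<close>. Let \<open>\<beta>\<^sub>c\<close> be its supremum.

  Below \<open>\<beta>\<^sub>c\<close>, a subinvariant section of a larger parameter \<open>\<beta>'\<close> misses invariance by at least
  \<open>c\<^sub>1 (\<beta>' - \<beta>)\<close>, and this forces the extremal graphs apart by the same amount
  (\<open>extremal_graphs\<close>). Conversely, if two graphs are uniformly separated, then by strong convexity their
  midpoint is subinvariant with a uniform margin, and hence stays subinvariant for slightly larger
  parameters (\<open>separated_persists\<close>). In particular \<open>\<beta>\<^sub>c > 0\<close>. At \<open>\<beta>\<^sub>c\<close> graphs exist, as monotone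
  limits of the extremal graphs for \<open>\<beta> \<nearrow> \<beta>\<^sub>c\<close>, and since there are none for \<open>\<beta> = 1\<close>, it follows that \<open>\<beta>\<^sub>c < 1\<close>; so no two of
  them can be uniformly separated.

  The Lyapunov exponents come from secants. Over an invariant set on which \<open>\<phi> < \<psi>\<close> are two invariant
  graphs, the logarithm of the slope of the secant of \<open>f\<^sub>\<beta>\<close> from \<open>\<phi>\<close> to \<open>\<psi>\<close> is the coboundary of
  \<open>ln (\<psi> - \<phi>)\<close> and so has integral zero (\<open>integral_coboundary\<close>), while by convexity it lies
  strictly between \<open>ln f\<^sub>\<beta>'(\<phi>)\<close> and \<open>ln f\<^sub>\<beta>'(\<psi>)\<close>. Thus the lower graph contracts and the
  upper one expands (\<open>exponent_signs\<close>). A third graph strictly between two others would do both, which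
  bounds the number of graphs. At \<open>\<beta>\<^sub>c\<close>, without ergodicity, the extremal graphs may coincide over an
  invariant set of intermediate measure; there the weak inequalities that survive the limit
  \<open>\<beta> \<nearrow> \<beta>\<^sub>c\<close> make the contribution to both exponents zero, so that the strict inequalities
  over the complement decide the signs.
\<close>

section \<open>Convex functions on an interval\<close>

text \<open>The derivatives provided by \<open>C2_on\<close> are arbitrary witnesses; since one-sided derivatives are
  unique on a nondegenerate interval, they are the ones computed by \<open>deriv_within\<close>.\<close>

lemma C2_on_deriv_within:
  assumes "a < b" "C2_on {a..b} g" "x \<in> {a..b}"
  shows "(g has_real_derivative deriv_within {a..b} g x) (at x within {a..b})"
    and "(deriv_within {a..b} g has_real_derivative
           deriv_within {a..b} (deriv_within {a..b} g) x) (at x within {a..b})"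
proof -
  obtain g' g'' where g': "\<And>x. x \<in> {a..b} \<Longrightarrow> (g has_real_derivative g' x) (at x within {a..b})"
    and g'': "\<And>x. x \<in> {a..b} \<Longrightarrow> (g' has_real_derivative g'' x) (at x within {a..b})"
    using assms(2) unfolding C2_on_def by blast
  have eq: "deriv_within {a..b} h y = h' y"
    if "y \<in> {a..b}" "(h has_real_derivative h' y) (at y within {a..b})" for h h' y
    unfolding deriv_within_def
    using that assms(1)
    using vector_derivative_within_closed_interval[of a b y h "h' y"]
    by (simp add: has_real_derivative_iff_has_vector_derivative)
  show *: "(g has_real_derivative deriv_within {a..b} g x) (at x within {a..b})"
    using eq[of x g g'] g' assms(3) by simp
  have "(deriv_within {a..b} g has_real_derivative g'' x) (at x within {a..b})"
    by (rule has_field_derivative_transform_within[OF g''[OF assms(3)] zero_less_one assms(3)])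
       (use eq[of _ g g'] g' in auto)
  then show "(deriv_within {a..b} g has_real_derivative
           deriv_within {a..b} (deriv_within {a..b} g) x) (at x within {a..b})"
    using eq[OF assms(3), of "deriv_within {a..b} g" g''] by simp
qed

lemma mean_value_within:
  fixes g :: "real \<Rightarrow> real"
  assumes "\<And>z. z \<in> {x..y} \<Longrightarrow> (g has_real_derivative g' z) (at z within S)"
    and "{x..y} \<subseteq> S" "x < y"
  obtains \<xi> where "\<xi> \<in> {x<..<y}" "g y - g x = g' \<xi> * (y - x)"
proof -
  have "\<exists>\<xi>\<in>{x<..<y}. g y - g x = g' \<xi> * (y - x)"
  proof (rule mvt_simple[OF assms(3), where f' = "\<lambda>z. (*) (g' z)"])
    fix z assume "x \<le> z" "z \<le> y"
    then show "(g has_derivative (*) (g' z)) (at z within {x..y})"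
      using assms(1)[of z] assms(2) unfolding has_field_derivative_def
      by (auto intro: has_derivative_subset)
  qed
  then show ?thesis using that by blast
qed

lemma secant_between_derivatives:
  fixes g :: "real \<Rightarrow> real"
  assumes "\<And>z. z \<in> {x..y} \<Longrightarrow> (g has_real_derivative g' z) (at z within S)"
    and "\<And>z. z \<in> {x..y} \<Longrightarrow> (g' has_real_derivative g'' z) (at z within S)"
    and "\<And>z. z \<in> {x..y} \<Longrightarrow> g'' z > 0"
    and "{x..y} \<subseteq> S" "x < y"
  shows "g' x < (g y - g x) / (y - x)" "(g y - g x) / (y - x) < g' y"
proof -
  have mono: "g' u < g' v" if uv: "x \<le> u" "u < v" "v \<le> y" for u v
  proof -
    obtain \<zeta> where \<zeta>: "\<zeta> \<in> {u<..<v}" "g' v - g' u = g'' \<zeta> * (v - u)"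
      by (rule mean_value_within[of u v g' g'' S]) (use assms(2,4) uv in auto)
    have "0 < g'' \<zeta> * (v - u)" using assms(3)[of \<zeta>] uv \<zeta>(1) by simp
    then show ?thesis using \<zeta>(2) by simp
  qed
  obtain \<xi> where \<xi>: "\<xi> \<in> {x<..<y}" "g y - g x = g' \<xi> * (y - x)"
    by (rule mean_value_within[of x y g g' S]) (use assms in auto)
  then have "(g y - g x) / (y - x) = g' \<xi>" using assms(5) by simp
  then show "g' x < (g y - g x) / (y - x)" "(g y - g x) / (y - x) < g' y"
    using mono[of x \<xi>] mono[of \<xi> y] \<xi> by auto
qed

text \<open>Subtracting \<open>c / 2 * z\<^sup>2\<close> leaves a convex function, for which the secants on the two halves of
  the interval are ordered; the quadratic term accounts for the gain of \<open>c / 8 * (y - x)\<^sup>2\<close>.\<close>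

lemma strongly_convex_midpoint:
  fixes g :: "real \<Rightarrow> real"
  assumes g': "\<And>z. z \<in> {x..y} \<Longrightarrow> (g has_real_derivative g' z) (at z within S)"
    and g'': "\<And>z. z \<in> {x..y} \<Longrightarrow> (g' has_real_derivative g'' z) (at z within S)"
    and c: "\<And>z. z \<in> {x..y} \<Longrightarrow> g'' z > c"
    and sub: "{x..y} \<subseteq> S" "x \<le> y"
  shows "g ((x + y) / 2) \<le> (g x + g y) / 2 - c / 8 * (y - x)\<^sup>2"
proof (cases "x = y")
  case False
  then have xy: "x < y" using sub by simp
  define m where "m = (x + y) / 2"
  define h where "h z = g z - c / 2 * z\<^sup>2" for z
  have h': "(h has_real_derivative g' z - c * z) (at z within S)" if "z \<in> {x..y}" for z
    unfolding h_def using g'[OF that] by (auto intro!: derivative_eq_intros)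
  have h'': "((\<lambda>z. g' z - c * z) has_real_derivative g'' z - c) (at z within S)"
    if "z \<in> {x..y}" for z
    using g''[OF that] by (auto intro!: derivative_eq_intros)
  have m: "x < m" "m < y" "m - x = (y - x) / 2" "y - m = (y - x) / 2"
    using xy by (auto simp: m_def field_simps)
  have 1: "(h m - h x) / (m - x) < g' m - c * m"
    using m sub c by (intro secant_between_derivatives(2)[OF h' h'']) auto
  have 2: "g' m - c * m < (h y - h m) / (y - m)"
    using m sub c by (intro secant_between_derivatives(1)[OF h' h'']) auto
  have "(h m - h x) / ((y - x) / 2) < (h y - h m) / ((y - x) / 2)"
    using 1 2 m(3,4) by simp
  then have "h m - h x \<le> h y - h m" using xy by (simp add: divide_less_cancel)
  moreover have "c / 2 * x\<^sup>2 + c / 2 * y\<^sup>2 - 2 * (c / 2 * m\<^sup>2) = c / 4 * (y - x)\<^sup>2"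
    unfolding m_def by (simp add: power2_eq_square field_simps)
  ultimately show ?thesis unfolding h_def m_def[symmetric] by argo
qed simp

section \<open>Coboundaries and exhaustion\<close>

text \<open>Although \<open>g\<close> itself need not be integrable, its truncations are bounded, so their coboundaries
  integrate to zero by invariance. Truncation is a contraction, so these coboundaries are dominated
  by that of \<open>g\<close>. For \<open>g = ln (\<psi> - \<phi>)\<close> this generality matters: nothing keeps \<open>\<phi>\<close> and \<open>\<psi>\<close>
  from being very close to each other.\<close>

lemma (in prob_space) integral_coboundary:
  fixes g :: "'a \<Rightarrow> real"
  assumes T: "T \<in> measurable M M" "distr M M T = M"
    and g: "g \<in> borel_measurable M"
    and int: "integrable M (\<lambda>x. g (T x) - g x)"
  shows "(\<integral>x. g (T x) - g x \<partial>M) = 0"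
proof -
  define t where "t n y = max (- real n) (min (real n) y)" for n y
  have t_meas[measurable]: "t n \<in> borel_measurable borel" for n unfolding t_def by measurable
  note T(1)[measurable] g[measurable]
  have t_bound: "\<bar>t n y\<bar> \<le> real n" for n y unfolding t_def by auto
  have int1: "integrable M (\<lambda>x. t n (g x))" "integrable M (\<lambda>x. t n (g (T x)))" for n
    by (auto intro!: integrable_const_bound[where B = "real n"] simp: t_bound)
  have eq: "(\<integral>x. t n (g (T x)) - t n (g x) \<partial>M) = 0" for n
  proof -
    have "(\<integral>x. t n (g x) \<partial>M) = (\<integral>x. t n (g x) \<partial>distr M M T)" using T by simp
    also have "\<dots> = (\<integral>x. t n (g (T x)) \<partial>M)" by (rule integral_distr) auto
    finally show ?thesis using int1 by simp
  qed
  have "(\<lambda>n. \<integral>x. t n (g (T x)) - t n (g x) \<partial>M) \<longlonglongrightarrow> (\<integral>x. g (T x) - g x \<partial>M)"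
  proof (rule integral_dominated_convergence[where w = "\<lambda>x. \<bar>g (T x) - g x\<bar>"])
    show "integrable M (\<lambda>x. \<bar>g (T x) - g x\<bar>)" using int by simp
    have conv: "(\<lambda>n. t n y) \<longlonglongrightarrow> y" for y
    proof (rule tendsto_eventually)
      obtain N where "\<bar>y\<bar> \<le> real N" using real_arch_simple by blast
      then show "\<forall>\<^sub>F n in sequentially. t n y = y"
        unfolding t_def eventually_sequentially by (intro exI[of _ N]) auto
    qed
    show "AE x in M. (\<lambda>n. t n (g (T x)) - t n (g x)) \<longlonglongrightarrow> g (T x) - g x"
      by (intro AE_I2 tendsto_diff conv)
    show "AE x in M. norm (t n (g (T x)) - t n (g x)) \<le> \<bar>g (T x) - g x\<bar>" for n
      by (intro AE_I2) (auto simp: t_def)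
  qed auto
  then have "(\<lambda>n::nat. 0) \<longlonglongrightarrow> (\<integral>x. g (T x) - g x \<partial>M)" unfolding eq .
  from LIMSEQ_unique[OF this tendsto_const] show ?thesis .
qed

text \<open>Exhaustion: the limit of running maxima along a sequence whose integrals approach the supremum
  has maximal integral, so its maximum with another member of the family can exceed it
  only on a null set. This replaces a pointwise supremum, which need not be measurable.\<close>

lemma (in prob_space) ae_greatest_element:
  fixes S :: "('a \<Rightarrow> real) set"
  assumes ne: "S \<noteq> {}"
    and meas: "\<And>u. u \<in> S \<Longrightarrow> u \<in> borel_measurable M"
    and bounded: "\<And>u x. u \<in> S \<Longrightarrow> x \<in> space M \<Longrightarrow> \<bar>u x\<bar> \<le> K"
    and max: "\<And>u v. u \<in> S \<Longrightarrow> v \<in> S \<Longrightarrow> (\<lambda>x. max (u x) (v x)) \<in> S"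
    and lim: "\<And>u v. (\<And>n. u n \<in> S) \<Longrightarrow> (\<And>x. x \<in> space M \<Longrightarrow> (\<lambda>n. u n x) \<longlonglongrightarrow> v x) \<Longrightarrow> v \<in> S"
  obtains m where "m \<in> S" "\<And>u. u \<in> S \<Longrightarrow> AE x in M. u x \<le> m x"
proof -
  have int: "integrable M u" if "u \<in> S" for u
    using meas[OF that] bounded[OF that]
    by (intro integrable_const_bound[where B = K]) auto
  define s where "s = (SUP u\<in>S. \<integral>x. u x \<partial>M)"
  have bdd: "bdd_above ((\<lambda>u. \<integral>x. u x \<partial>M) ` S)"
  proof (rule bdd_aboveI2)
    fix u assume u: "u \<in> S"
    have "(\<integral>x. u x \<partial>M) \<le> (\<integral>x. K \<partial>M)"
      using int[OF u] bounded[OF u] by (intro integral_mono) (auto simp: abs_le_iff)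
    then show "(\<integral>x. u x \<partial>M) \<le> K" by (simp add: prob_space)
  qed
  have le_s: "(\<integral>x. u x \<partial>M) \<le> s" if "u \<in> S" for u
    unfolding s_def using that bdd by (rule cSUP_upper)
  have "\<exists>u\<in>S. s - 1 / real (Suc n) < (\<integral>x. u x \<partial>M)" for n
  proof -
    have "s - 1 / real (Suc n) < s" by simp
    then show ?thesis unfolding s_def using less_cSUP_iff[OF ne bdd] by auto
  qed
  then obtain p where p: "\<And>n. p n \<in> S" "\<And>n. s - 1 / real (Suc n) < (\<integral>x. p n x \<partial>M)" by metis
  define q where "q = rec_nat (p 0) (\<lambda>n r x. max (r x) (p (Suc n) x))"
  have q_simps: "q 0 = p 0" "q (Suc n) = (\<lambda>x. max (q n x) (p (Suc n) x))" for n
    by (simp_all add: q_def)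
  have qS: "q n \<in> S" for n by (induction n) (auto simp: q_simps intro: p max)
  have q_inc: "incseq (\<lambda>n. q n x)" for x by (rule incseq_SucI) (simp add: q_simps)
  have pq: "p n x \<le> q n x" for n x by (cases n) (auto simp: q_simps)
  define m where "m x = lim (\<lambda>n. q n x)" for x
  have conv: "(\<lambda>n. q n x) \<longlonglongrightarrow> m x" if "x \<in> space M" for x
  proof -
    have "convergent (\<lambda>n. q n x)"
      using bounded[OF qS that] q_inc
      by (intro Bseq_mono_convergent BseqI'[where K = K]) (auto simp: incseq_def)
    then show ?thesis unfolding m_def using convergent_LIMSEQ_iff by blast
  qed
  have mS: "m \<in> S" using qS conv by (rule lim)
  have q_le_m: "q n x \<le> m x" if "x \<in> space M" for n x
    using incseq_le[OF q_inc conv[OF that]] .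
  have "s \<le> (\<integral>x. m x \<partial>M)"
  proof (rule LIMSEQ_le_const2)
    show "(\<lambda>n. s - 1 / real (Suc n)) \<longlonglongrightarrow> s"
      using tendsto_diff[OF tendsto_const LIMSEQ_inverse_real_of_nat, of s]
      by (simp add: inverse_eq_divide)
    have "(\<integral>x. p n x \<partial>M) \<le> (\<integral>x. m x \<partial>M)" for n
      using int[OF p(1)] int[OF mS] order_trans[OF pq q_le_m] by (intro integral_mono) auto
    then show "\<exists>N. \<forall>n\<ge>N. s - 1 / real (Suc n) \<le> (\<integral>x. m x \<partial>M)"
      using p(2) by (meson less_le_trans less_imp_le)
  qed
  then have s_eq: "(\<integral>x. m x \<partial>M) = s" using le_s[OF mS] by simp
  have "AE x in M. u x \<le> m x" if u: "u \<in> S" for u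
  proof -
    let ?w = "\<lambda>x. max (m x) (u x)"
    have w: "?w \<in> S" using mS u by (rule max)
    have int_d: "integrable M (\<lambda>x. ?w x - m x)" using int[OF w] int[OF mS] by simp
    have "(\<integral>x. ?w x - m x \<partial>M) \<le> 0" using le_s[OF w] s_eq int[OF w] int[OF mS] by simp
    moreover have "0 \<le> (\<integral>x. ?w x - m x \<partial>M)" by (rule integral_nonneg_AE) auto
    ultimately have "(\<integral>x. ?w x - m x \<partial>M) = 0" by simp
    then have "AE x in M. ?w x - m x = 0"
      using integral_nonneg_eq_0_iff_AE[OF int_d] by simp
    then show ?thesis by eventually_elim auto
  qed
  then show ?thesis using mS that by blast
qed

section \<open>Families of forced convex maps\<close>

text \<open>The hypotheses on the family other than the one on the graphs at \<open>\<beta> = 0\<close> and \<open>\<beta> = 1\<close>, with the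
  constants fixed.\<close>

locale forced_convex_family =
  fixes M :: "'a measure" and \<omega> :: "'a \<Rightarrow> 'a" and a b :: real
    and f :: "real \<Rightarrow> 'a \<Rightarrow> real \<Rightarrow> real" and \<gamma>m \<gamma>p :: "'a \<Rightarrow> real" and c1 C c2 :: real
  assumes mpds: "measure_preserving_system M \<omega>"
    and ab: "a < b"
    and family: "\<And>\<beta>. \<beta> \<in> {0..1} \<Longrightarrow> forced_C2_interval_map M \<omega> {a..b} (f \<beta>)"
    and \<gamma>m: "\<gamma>m \<in> measurable M (restrict_space borel {a..b})"
    and \<gamma>p: "\<gamma>p \<in> measurable M (restrict_space borel {a..b})"
    and \<gamma>_less: "AE \<theta> in M. \<gamma>m \<theta> < \<gamma>p \<theta>"
    and \<gamma>_super: "AE \<theta> in M. \<forall>\<beta>\<in>{0..1}.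
               f \<beta> \<theta> (\<gamma>m \<theta>) \<ge> \<gamma>m (\<omega> \<theta>) \<and> f \<beta> \<theta> (\<gamma>p \<theta>) \<ge> \<gamma>p (\<omega> \<theta>)"
    and cont: "AE \<theta> in M.
               continuous_on ({0..1} \<times> {a..b}) (\<lambda>(\<beta>, x). f \<beta> \<theta> x) \<and>
               continuous_on ({0..1} \<times> {a..b}) (\<lambda>(\<beta>, x). deriv_within {a..b} (f \<beta> \<theta>) x)"
    and \<eta>_int: "integrable M
               (\<lambda>\<theta>. SUP (\<beta>, x)\<in>{0..1} \<times> {\<gamma>m \<theta>..\<gamma>p \<theta>}. \<bar>ln (deriv_within {a..b} (f \<beta> \<theta>) x)\<bar>)"
    and deriv_pos: "AE \<theta> in M. \<forall>\<beta>\<in>{0..1}. \<forall>x\<in>{\<gamma>m \<theta>..\<gamma>p \<theta>}. deriv_within {a..b} (f \<beta> \<theta>) x > 0"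
    and c1: "0 < c1" "c1 \<le> C"
    and parameter: "AE \<theta> in M. \<forall>\<beta>\<in>{0..1}. \<forall>x\<in>{\<gamma>m \<theta>..\<gamma>p \<theta>}.
                  (\<lambda>s. f s \<theta> x) differentiable (at \<beta> within {0..1}) \<and>
                  c1 \<le> deriv_within {0..1} (\<lambda>s. f s \<theta> x) \<beta> \<and>
                  deriv_within {0..1} (\<lambda>s. f s \<theta> x) \<beta> \<le> C"
    and c2: "c2 > 0"
    and convex: "AE \<theta> in M. \<forall>\<beta>\<in>{0..1}. \<forall>x\<in>{\<gamma>m \<theta>..\<gamma>p \<theta>}.
               deriv_within {a..b} (deriv_within {a..b} (f \<beta> \<theta>)) x > c2"
begin

abbreviation section_space :: "real measure" where
  "section_space \<equiv> restrict_space borel {a..b}"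

abbreviation D :: "real \<Rightarrow> 'a \<Rightarrow> real \<Rightarrow> real" where
  "D \<beta> \<theta> \<equiv> deriv_within {a..b} (f \<beta> \<theta>)"

abbreviation \<Gamma> :: "'a \<Rightarrow> real set" where
  "\<Gamma> \<theta> \<equiv> {\<gamma>m \<theta>..\<gamma>p \<theta>}"

abbreviation graph :: "real \<Rightarrow> ('a \<Rightarrow> real) \<Rightarrow> bool" where
  "graph \<beta> \<equiv> invariant_graph_in M \<omega> {a..b} (f \<beta>) \<Gamma>"

definition \<eta> :: "'a \<Rightarrow> real" where
  "\<eta> \<theta> = (SUP (\<beta>, x)\<in>{0..1} \<times> \<Gamma> \<theta>. \<bar>ln (D \<beta> \<theta> x)\<bar>)"

definition subinvariant :: "real \<Rightarrow> ('a \<Rightarrow> real) \<Rightarrow> bool" where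
  "subinvariant \<beta> \<psi> \<longleftrightarrow> \<psi> \<in> measurable M section_space \<and> (AE \<theta> in M. \<psi> \<theta> \<in> \<Gamma> \<theta>) \<and>
     (AE \<theta> in M. f \<beta> \<theta> (\<psi> \<theta>) \<le> \<psi> (\<omega> \<theta>))"

text \<open>All fibrewise hypotheses at once, so that the analysis of a single fibre map is free of
  exceptional sets.\<close>

definition regular :: "'a \<Rightarrow> bool" where
  "regular \<theta> \<longleftrightarrow> \<theta> \<in> space M \<and> \<gamma>m \<theta> < \<gamma>p \<theta> \<and>
     (\<forall>\<beta>\<in>{0..1}. f \<beta> \<theta> (\<gamma>m \<theta>) \<ge> \<gamma>m (\<omega> \<theta>) \<and> f \<beta> \<theta> (\<gamma>p \<theta>) \<ge> \<gamma>p (\<omega> \<theta>)) \<and>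
     continuous_on ({0..1} \<times> {a..b}) (\<lambda>(\<beta>, x). f \<beta> \<theta> x) \<and>
     continuous_on ({0..1} \<times> {a..b}) (\<lambda>(\<beta>, x). D \<beta> \<theta> x) \<and>
     (\<forall>\<beta>\<in>{0..1}. \<forall>x\<in>\<Gamma> \<theta>. D \<beta> \<theta> x > 0 \<and>
        (\<lambda>s. f s \<theta> x) differentiable (at \<beta> within {0..1}) \<and>
        c1 \<le> deriv_within {0..1} (\<lambda>s. f s \<theta> x) \<beta> \<and>
        deriv_within {0..1} (\<lambda>s. f s \<theta> x) \<beta> \<le> C \<and>
        deriv_within {a..b} (D \<beta> \<theta>) x > c2)"

lemma AE_regular: "AE \<theta> in M. regular \<theta>"
  using AE_space \<gamma>_less \<gamma>_super cont deriv_pos parameter convex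
  by eventually_elim (simp add: regular_def)

sublocale prob_space M
  using mpds by (simp add: measure_preserving_system_def)

lemma \<omega>_measurable[measurable]: "\<omega> \<in> measurable M M"
  and \<omega>_distr: "distr M M \<omega> = M"
  using mpds by (simp_all add: measure_preserving_system_def)

lemma AE_\<omega>:
  assumes "AE \<theta> in M. P \<theta>" shows "AE \<theta> in M. P (\<omega> \<theta>)"
  by (rule AE_distrD[OF \<omega>_measurable]) (use assms in \<open>simp only: \<omega>_distr\<close>)

abbreviation \<omega>_inv :: "'a \<Rightarrow> 'a" where
  "\<omega>_inv \<equiv> the_inv_into (space M) \<omega>"

lemma \<omega>_inv_measurable[measurable]: "\<omega>_inv \<in> measurable M M"
  using mpds by (simp add: measure_preserving_system_def)

lemma \<omega>_bij: "bij_betw \<omega> (space M) (space M)"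
  using mpds by (simp add: measure_preserving_system_def)

lemma \<omega>_inv_\<omega>: "\<theta> \<in> space M \<Longrightarrow> \<omega>_inv (\<omega> \<theta>) = \<theta>"
  using \<omega>_bij by (simp add: bij_betw_def the_inv_into_f_f)

lemma \<omega>_\<omega>_inv: "\<theta> \<in> space M \<Longrightarrow> \<omega> (\<omega>_inv \<theta>) = \<theta>"
  using \<omega>_bij by (simp add: f_the_inv_into_f_bij_betw)

lemma \<omega>_inv_distr: "distr M M \<omega>_inv = M"
proof -
  have "distr M M \<omega>_inv = distr (distr M M \<omega>) M \<omega>_inv" by (simp add: \<omega>_distr)
  also have "\<dots> = distr M M (\<omega>_inv \<circ> \<omega>)" by (rule distr_distr) auto
  also have "\<dots> = distr M M (\<lambda>\<theta>. \<theta>)" by (rule distr_cong) (auto simp: \<omega>_inv_\<omega>)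
  also have "\<dots> = M" by (rule distr_id)
  finally show ?thesis .
qed

text \<open>Since the inverse of \<open>\<omega>\<close> also preserves the measure, a relation between functions may be
  checked along \<open>\<omega>\<close>. This converts statements about \<open>f\<^sub>\<beta>(\<phi>) = \<phi> \<circ> \<omega>\<close> into statements about \<open>\<phi>\<close>.\<close>

lemma AE_\<omega>_cancel:
  assumes "AE \<theta> in M. P (\<omega> \<theta>)" shows "AE \<theta> in M. P \<theta>"
proof -
  have "AE \<theta> in M. P (\<omega> (\<omega>_inv \<theta>))"
    by (rule AE_distrD[OF \<omega>_inv_measurable]) (use assms in \<open>simp only: \<omega>_inv_distr\<close>)
  with AE_space show ?thesis by eventually_elim (simp add: \<omega>_\<omega>_inv)
qed

lemma section_iff:
  "\<psi> \<in> measurable M section_space \<longleftrightarrow>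
     \<psi> \<in> borel_measurable M \<and> (\<forall>\<theta>\<in>space M. \<psi> \<theta> \<in> {a..b})"
  by (auto simp: measurable_restrict_space2_iff)

lemma \<gamma>_in: "\<theta> \<in> space M \<Longrightarrow> \<gamma>m \<theta> \<in> {a..b}" "\<theta> \<in> space M \<Longrightarrow> \<gamma>p \<theta> \<in> {a..b}"
  using \<gamma>m \<gamma>p by (auto simp: section_iff)

lemma regularD:
  assumes "regular \<theta>"
  shows "\<theta> \<in> space M" "\<gamma>m \<theta> < \<gamma>p \<theta>" "\<Gamma> \<theta> \<subseteq> {a..b}"
    and "\<beta> \<in> {0..1} \<Longrightarrow> \<gamma>m (\<omega> \<theta>) \<le> f \<beta> \<theta> (\<gamma>m \<theta>)"
    and "\<beta> \<in> {0..1} \<Longrightarrow> \<gamma>p (\<omega> \<theta>) \<le> f \<beta> \<theta> (\<gamma>p \<theta>)"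
    and "\<beta> \<in> {0..1} \<Longrightarrow> x \<in> \<Gamma> \<theta> \<Longrightarrow> D \<beta> \<theta> x > 0"
  using assms \<gamma>_in[of \<theta>] by (auto simp: regular_def)

lemma section_image_measurable:
  assumes "\<beta> \<in> {0..1}" "\<psi> \<in> measurable M section_space"
  shows "(\<lambda>\<theta>. f \<beta> \<theta> (\<psi> \<theta>)) \<in> measurable M section_space"
proof -
  have *: "(\<lambda>(\<theta>, x). (\<omega> \<theta>, f \<beta> \<theta> x)) \<in>
      measurable (M \<Otimes>\<^sub>M section_space) (M \<Otimes>\<^sub>M section_space)"
    using family[OF assms(1)] by (simp add: forced_C2_interval_map_def)
  have "(\<lambda>\<theta>. (\<theta>, \<psi> \<theta>)) \<in> measurable M (M \<Otimes>\<^sub>M section_space)"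
    using assms(2) by simp
  from measurable_compose[OF measurable_compose[OF this *] measurable_snd]
  show ?thesis by simp
qed

lemma fibre_derivatives:
  assumes "\<beta> \<in> {0..1}" "\<theta> \<in> space M" "x \<in> {a..b}"
  shows "(f \<beta> \<theta> has_real_derivative D \<beta> \<theta> x) (at x within {a..b})"
    and "(D \<beta> \<theta> has_real_derivative deriv_within {a..b} (D \<beta> \<theta>) x) (at x within {a..b})"
  using C2_on_deriv_within[OF ab _ assms(3)] family[OF assms(1)] assms(2)
  by (auto simp: forced_C2_interval_map_def)

text \<open>The derivative along a section is a limit of difference quotients, each of which is measurable
  because the skew product is. The increment points to the farther end of the interval, which keeps the
  second point inside it.\<close>

lemma section_deriv_measurable:
  assumes \<beta>: "\<beta> \<in> {0..1}" and \<psi>: "\<psi> \<in> measurable M section_space"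
  shows "(\<lambda>\<theta>. D \<beta> \<theta> (\<psi> \<theta>)) \<in> borel_measurable M"
proof -
  \<comment> \<open>With the summand \<open>2\<close> the increment never exceeds half the length of the interval.\<close>
  define h where "h n = (b - a) / real (n + 2)" for n
  have h: "0 < h n" "h n \<le> (b - a) / 2" for n
    using ab divide_left_mono[of 2 "real (n + 2)" "b - a"] by (simp_all add: h_def)
  define p where "p n \<theta> = (if \<psi> \<theta> \<le> (a + b) / 2 then \<psi> \<theta> + h n else \<psi> \<theta> - h n)" for n \<theta>
  have p_sect: "p n \<in> measurable M section_space" for n
    using \<psi> h[of n] unfolding section_iff p_def by (auto simp: field_simps)
  show ?thesis
  proof (rule borel_measurable_LIMSEQ_real)
    show "(\<lambda>\<theta>. (f \<beta> \<theta> (p n \<theta>) - f \<beta> \<theta> (\<psi> \<theta>)) / (p n \<theta> - \<psi> \<theta>)) \<in> borel_measurable M" for n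
      using section_image_measurable[OF \<beta> p_sect[of n]] section_image_measurable[OF \<beta> \<psi>]
        p_sect[of n] \<psi> by (auto simp: section_iff)
  next
    fix \<theta> assume \<theta>: "\<theta> \<in> space M"
    then have \<psi>\<theta>: "\<psi> \<theta> \<in> {a..b}" using \<psi> by (simp add: section_iff)
    have "h \<longlonglongrightarrow> 0" unfolding h_def
      by real_asymp
    from tendsto_add[OF tendsto_const this, of "\<psi> \<theta>"] tendsto_diff[OF tendsto_const this, of "\<psi> \<theta>"]
    have "(\<lambda>n. p n \<theta>) \<longlonglongrightarrow> \<psi> \<theta>"
      unfolding p_def by (cases "\<psi> \<theta> \<le> (a + b) / 2") simp_all
    moreover have "p n \<theta> \<in> {a..b} - {\<psi> \<theta>}" for n
      using p_sect[of n] \<theta> h[of n] by (auto simp: section_iff) (auto simp: p_def split: if_splits)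
    ultimately have "filterlim (\<lambda>n. p n \<theta>) (at (\<psi> \<theta>) within {a..b}) sequentially"
      by (auto simp: filterlim_at)
    then show "(\<lambda>n. (f \<beta> \<theta> (p n \<theta>) - f \<beta> \<theta> (\<psi> \<theta>)) / (p n \<theta> - \<psi> \<theta>)) \<longlonglongrightarrow> D \<beta> \<theta> (\<psi> \<theta>)"
      using fibre_derivatives(1)[OF \<beta> \<theta> \<psi>\<theta>] unfolding has_field_derivative_iff
      by (rule filterlim_compose[rotated])
  qed
qed

text \<open>Boundedness has to be checked before the supremum \<open>\<eta>\<close> is meaningful: the derivative is
  continuous and positive on the compact rectangle over \<open>\<theta>\<close>.\<close>

lemma abs_ln_deriv_le_\<eta>:
  assumes \<theta>: "regular \<theta>" and "\<beta> \<in> {0..1}" "x \<in> \<Gamma> \<theta>"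
  shows "\<bar>ln (D \<beta> \<theta> x)\<bar> \<le> \<eta> \<theta>"
proof -
  have "continuous_on ({0..1} \<times> \<Gamma> \<theta>) (\<lambda>(\<beta>, x). D \<beta> \<theta> x)"
    using \<theta> regularD(3)[OF \<theta>]
    by (auto simp: regular_def elim!: continuous_on_subset)
  then have "continuous_on ({0..1} \<times> \<Gamma> \<theta>) (\<lambda>z. \<bar>ln ((\<lambda>(\<beta>, x). D \<beta> \<theta> x) z)\<bar>)"
    using regularD(6)[OF \<theta>] by (intro continuous_intros) fastforce+
  then have "compact ((\<lambda>z. \<bar>ln ((\<lambda>(\<beta>, x). D \<beta> \<theta> x) z)\<bar>) ` ({0..1} \<times> \<Gamma> \<theta>))"
    by (intro compact_continuous_image compact_Times) auto
  then have "bdd_above ((\<lambda>(\<beta>, x). \<bar>ln (D \<beta> \<theta> x)\<bar>) ` ({0..1} \<times> \<Gamma> \<theta>))"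
    by (simp add: case_prod_unfold compact_imp_bounded bounded_imp_bdd_above)
  then show ?thesis
    unfolding \<eta>_def using assms(2,3) cSUP_upper[of "(\<beta>, x)" "{0..1} \<times> \<Gamma> \<theta>" "\<lambda>(\<beta>, x). \<bar>ln (D \<beta> \<theta> x)\<bar>"]
    by auto
qed

section \<open>Monotonicity, convexity and parameter dependence in a fibre\<close>

lemma secant_bounds:
  assumes \<theta>: "regular \<theta>" and \<beta>: "\<beta> \<in> {0..1}" and xy: "x \<in> \<Gamma> \<theta>" "y \<in> \<Gamma> \<theta>" "x < y"
  shows "D \<beta> \<theta> x < (f \<beta> \<theta> y - f \<beta> \<theta> x) / (y - x)"
    and "(f \<beta> \<theta> y - f \<beta> \<theta> x) / (y - x) < D \<beta> \<theta> y"
proof -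
  have sub: "{x..y} \<subseteq> {a..b}" using regularD(3)[OF \<theta>] xy by auto
  have pos: "deriv_within {a..b} (D \<beta> \<theta>) z > 0" if "z \<in> {x..y}" for z
  proof -
    have "z \<in> \<Gamma> \<theta>" using that xy by auto
    then have "deriv_within {a..b} (D \<beta> \<theta>) z > c2" using \<theta> \<beta> by (simp add: regular_def)
    then show ?thesis using c2 by simp
  qed
  note fd = fibre_derivatives[OF \<beta> regularD(1)[OF \<theta>] subsetD[OF sub]]
  show "D \<beta> \<theta> x < (f \<beta> \<theta> y - f \<beta> \<theta> x) / (y - x)"
    by (rule secant_between_derivatives(1)[OF fd pos sub xy(3)])
  show "(f \<beta> \<theta> y - f \<beta> \<theta> x) / (y - x) < D \<beta> \<theta> y"
    by (rule secant_between_derivatives(2)[OF fd pos sub xy(3)])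
qed

lemma fibre_less_iff:
  assumes "regular \<theta>" "\<beta> \<in> {0..1}" "x \<in> \<Gamma> \<theta>" "y \<in> \<Gamma> \<theta>"
  shows "f \<beta> \<theta> x < f \<beta> \<theta> y \<longleftrightarrow> x < y"
proof -
  have *: "f \<beta> \<theta> u < f \<beta> \<theta> v" if "u \<in> \<Gamma> \<theta>" "v \<in> \<Gamma> \<theta>" "u < v" for u v
    using secant_bounds(1)[OF assms(1,2) that] regularD(6)[OF assms(1,2) that(1)] that(3)
    by (simp add: pos_less_divide_eq) (smt (verit) mult_pos_pos)
  show ?thesis using *[of x y] *[of y x] assms by (cases x y rule: linorder_cases) auto
qed

lemma fibre_le_iff:
  assumes "regular \<theta>" "\<beta> \<in> {0..1}" "x \<in> \<Gamma> \<theta>" "y \<in> \<Gamma> \<theta>"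
  shows "f \<beta> \<theta> x \<le> f \<beta> \<theta> y \<longleftrightarrow> x \<le> y"
  using fibre_less_iff[OF assms(1,2,4,3)] by (auto simp: not_less[symmetric])

lemma fibre_lipschitz:
  assumes \<theta>: "regular \<theta>" and \<beta>: "\<beta> \<in> {0..1}" and xy: "x \<in> \<Gamma> \<theta>" "y \<in> \<Gamma> \<theta>" "x \<le> y"
  shows "f \<beta> \<theta> y - f \<beta> \<theta> x \<le> exp (\<eta> \<theta>) * (y - x)"
proof (cases "x = y")
  case False
  then have "x < y" using xy by simp
  have "D \<beta> \<theta> y \<le> exp (\<eta> \<theta>)"
    using abs_ln_deriv_le_\<eta>[OF \<theta> \<beta> xy(2)] regularD(6)[OF \<theta> \<beta> xy(2)]
    by (metis abs_le_D1 exp_le_cancel_iff exp_ln)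
  with secant_bounds(2)[OF \<theta> \<beta> xy(1,2) \<open>x < y\<close>]
  have "(f \<beta> \<theta> y - f \<beta> \<theta> x) / (y - x) \<le> exp (\<eta> \<theta>)" by simp
  then show ?thesis using \<open>x < y\<close> by (simp add: pos_divide_le_eq)
qed simp

lemma fibre_midpoint:
  assumes \<theta>: "regular \<theta>" and \<beta>: "\<beta> \<in> {0..1}" and xy: "x \<in> \<Gamma> \<theta>" "y \<in> \<Gamma> \<theta>" "x \<le> y"
  shows "f \<beta> \<theta> ((x + y) / 2) \<le> (f \<beta> \<theta> x + f \<beta> \<theta> y) / 2 - c2 / 8 * (y - x)\<^sup>2"
proof -
  have sub: "{x..y} \<subseteq> {a..b}" using regularD(3)[OF \<theta>] xy by auto
  have "deriv_within {a..b} (D \<beta> \<theta>) z > c2" if "z \<in> {x..y}" for z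
    using \<theta> \<beta> xy that by (simp add: regular_def)
  then show ?thesis
    using strongly_convex_midpoint[OF
        fibre_derivatives[OF \<beta> regularD(1)[OF \<theta>] subsetD[OF sub]] _ sub xy(3)] by blast
qed

lemma fibre_parameter:
  assumes \<theta>: "regular \<theta>" and \<beta>: "0 \<le> \<beta>" "\<beta> \<le> \<beta>'" "\<beta>' \<le> 1" and x: "x \<in> \<Gamma> \<theta>"
  shows "c1 * (\<beta>' - \<beta>) \<le> f \<beta>' \<theta> x - f \<beta> \<theta> x"
    and "f \<beta>' \<theta> x - f \<beta> \<theta> x \<le> C * (\<beta>' - \<beta>)"
proof -
  let ?d = "deriv_within {0..1} (\<lambda>s. f s \<theta> x)"
  have der: "((\<lambda>s. f s \<theta> x) has_real_derivative ?d s) (at s within {0..1})" if "s \<in> {0..1}" for s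
    using \<theta> x that
    by (simp add: regular_def deriv_within_def has_real_derivative_iff_has_vector_derivative
        vector_derivative_works)
  have "c1 * (\<beta>' - \<beta>) \<le> f \<beta>' \<theta> x - f \<beta> \<theta> x \<and> f \<beta>' \<theta> x - f \<beta> \<theta> x \<le> C * (\<beta>' - \<beta>)"
  proof (cases "\<beta> = \<beta>'")
    case False
    then have less: "\<beta> < \<beta>'" using \<beta> by simp
    obtain s where s: "s \<in> {\<beta><..<\<beta>'}" "f \<beta>' \<theta> x - f \<beta> \<theta> x = ?d s * (\<beta>' - \<beta>)"
      by (rule mean_value_within[of \<beta> \<beta>' "\<lambda>s. f s \<theta> x" ?d "{0..1}"])
        (use der \<beta> less in auto)
    have "c1 \<le> ?d s" "?d s \<le> C" using \<theta> x s(1) \<beta> by (auto simp: regular_def)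
    then show ?thesis unfolding s(2) using less by (simp add: mult_right_mono)
  qed simp
  then show "c1 * (\<beta>' - \<beta>) \<le> f \<beta>' \<theta> x - f \<beta> \<theta> x"
    and "f \<beta>' \<theta> x - f \<beta> \<theta> x \<le> C * (\<beta>' - \<beta>)" by auto
qed

lemma fibre_tendsto:
  assumes \<theta>: "regular \<theta>" and "\<And>n. \<beta> n \<in> {0..1}" "\<beta> \<longlonglongrightarrow> \<beta>'" "\<And>n. u n \<in> {a..b}" "u \<longlonglongrightarrow> x"
  shows "(\<lambda>n. f (\<beta> n) \<theta> (u n)) \<longlonglongrightarrow> f \<beta>' \<theta> x"
    and "(\<lambda>n. D (\<beta> n) \<theta> (u n)) \<longlonglongrightarrow> D \<beta>' \<theta> x"
proof -
  have lim: "(\<lambda>n. (\<beta> n, u n)) \<longlonglongrightarrow> (\<beta>', x)" using assms by (intro tendsto_Pair)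
  have cl: "closed ({0..1::real} \<times> {a..b})" by (intro closed_Times) auto
  have in_rect: "(\<beta>', x) \<in> {0..1} \<times> {a..b}"
    by (rule closed_sequentially[OF cl _ lim]) (use assms in auto)
  have *: "(\<lambda>n. (case (\<beta> n, u n) of (\<beta>, x) \<Rightarrow> h \<beta> \<theta> x)) \<longlonglongrightarrow> (case (\<beta>', x) of (\<beta>, x) \<Rightarrow> h \<beta> \<theta> x)"
    if "continuous_on ({0..1} \<times> {a..b}) (\<lambda>(\<beta>, x). h \<beta> \<theta> x)" for h :: "real \<Rightarrow> 'a \<Rightarrow> real \<Rightarrow> real"
    by (rule continuous_on_tendsto_compose[OF that lim in_rect]) (use assms in auto)
  show "(\<lambda>n. f (\<beta> n) \<theta> (u n)) \<longlonglongrightarrow> f \<beta>' \<theta> x" "(\<lambda>n. D (\<beta> n) \<theta> (u n)) \<longlonglongrightarrow> D \<beta>' \<theta> x"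
    using *[of f] *[of D] \<theta> unfolding regular_def by simp_all
qed

section \<open>Subinvariant sections and extremal graphs\<close>

lemma graph_iff:
  "graph \<beta> \<psi> \<longleftrightarrow> \<psi> \<in> measurable M section_space \<and> (AE \<theta> in M. \<psi> \<theta> \<in> \<Gamma> \<theta>) \<and>
     (AE \<theta> in M. f \<beta> \<theta> (\<psi> \<theta>) = \<psi> (\<omega> \<theta>))"
  by (auto simp: invariant_graph_in_def invariant_graph_def)

lemma graph_subinvariant: "graph \<beta> \<psi> \<Longrightarrow> subinvariant \<beta> \<psi>"
  unfolding graph_iff subinvariant_def by (auto elim: AE_mp)

text \<open>Lowering the parameter not only preserves subinvariance but creates a uniform margin.\<close>

lemma subinvariant_mono:
  assumes "subinvariant \<beta>' \<psi>" "0 \<le> \<beta>" "\<beta> \<le> \<beta>'" "\<beta>' \<le> 1"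
  shows "AE \<theta> in M. f \<beta> \<theta> (\<psi> \<theta>) \<le> \<psi> (\<omega> \<theta>) - c1 * (\<beta>' - \<beta>)"
    and "subinvariant \<beta> \<psi>"
proof -
  have "AE \<theta> in M. \<psi> \<theta> \<in> \<Gamma> \<theta>" "AE \<theta> in M. f \<beta>' \<theta> (\<psi> \<theta>) \<le> \<psi> (\<omega> \<theta>)"
    using assms(1) by (auto simp: subinvariant_def)
  then show *: "AE \<theta> in M. f \<beta> \<theta> (\<psi> \<theta>) \<le> \<psi> (\<omega> \<theta>) - c1 * (\<beta>' - \<beta>)"
    using AE_regular
  proof eventually_elim
    case (elim \<theta>)
    then show ?case using fibre_parameter(1)[OF elim(3) assms(2-4) elim(1)] by linarith
  qed
  have "0 \<le> c1 * (\<beta>' - \<beta>)" using c1 assms by simp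
  with * have "AE \<theta> in M. f \<beta> \<theta> (\<psi> \<theta>) \<le> \<psi> (\<omega> \<theta>)" by (auto elim!: AE_mp)
  then show "subinvariant \<beta> \<psi>" using assms(1) by (simp add: subinvariant_def)
qed

lemma subinvariant_max_min:
  assumes "subinvariant \<beta> \<phi>" "subinvariant \<beta> \<psi>" and \<beta>: "\<beta> \<in> {0..1}"
  shows "subinvariant \<beta> (\<lambda>\<theta>. max (\<phi> \<theta>) (\<psi> \<theta>))" "subinvariant \<beta> (\<lambda>\<theta>. min (\<phi> \<theta>) (\<psi> \<theta>))"
proof -
  have m: "(\<lambda>\<theta>. max (\<phi> \<theta>) (\<psi> \<theta>)) \<in> measurable M section_space"
    "(\<lambda>\<theta>. min (\<phi> \<theta>) (\<psi> \<theta>)) \<in> measurable M section_space"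
    using assms by (auto simp: subinvariant_def section_iff max_def min_def)
  have *: "AE \<theta> in M. \<phi> \<theta> \<in> \<Gamma> \<theta>" "AE \<theta> in M. f \<beta> \<theta> (\<phi> \<theta>) \<le> \<phi> (\<omega> \<theta>)"
    "AE \<theta> in M. \<psi> \<theta> \<in> \<Gamma> \<theta>" "AE \<theta> in M. f \<beta> \<theta> (\<psi> \<theta>) \<le> \<psi> (\<omega> \<theta>)"
    using assms by (auto simp: subinvariant_def)
  have "AE \<theta> in M. max (\<phi> \<theta>) (\<psi> \<theta>) \<in> \<Gamma> \<theta>" "AE \<theta> in M. min (\<phi> \<theta>) (\<psi> \<theta>) \<in> \<Gamma> \<theta>"
    using *(1,3) by (eventually_elim; auto)+
  moreover have "AE \<theta> in M. f \<beta> \<theta> (max (\<phi> \<theta>) (\<psi> \<theta>)) \<le> max (\<phi> (\<omega> \<theta>)) (\<psi> (\<omega> \<theta>))"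
    "AE \<theta> in M. f \<beta> \<theta> (min (\<phi> \<theta>) (\<psi> \<theta>)) \<le> min (\<phi> (\<omega> \<theta>)) (\<psi> (\<omega> \<theta>))"
    using * AE_regular
    by (eventually_elim; simp add: max_def min_def; use fibre_le_iff[OF _ \<beta>] in \<open>smt (verit) atLeastAtMost_iff\<close>)+
  ultimately show "subinvariant \<beta> (\<lambda>\<theta>. max (\<phi> \<theta>) (\<psi> \<theta>))"
    "subinvariant \<beta> (\<lambda>\<theta>. min (\<phi> \<theta>) (\<psi> \<theta>))"
    using m by (auto simp: subinvariant_def)
qed

lemma section_limit:
  assumes "\<And>n. u n \<in> measurable M section_space" "\<And>n. AE \<theta> in M. u n \<theta> \<in> \<Gamma> \<theta>"
    and lim: "\<And>\<theta>. \<theta> \<in> space M \<Longrightarrow> (\<lambda>n. u n \<theta>) \<longlonglongrightarrow> v \<theta>"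
  shows "v \<in> measurable M section_space" "AE \<theta> in M. v \<theta> \<in> \<Gamma> \<theta>"
proof -
  have "v \<theta> \<in> {a..b}" if "\<theta> \<in> space M" for \<theta>
    by (rule closed_sequentially[OF _ _ lim[OF that]]) (use assms(1) that in \<open>auto simp: section_iff\<close>)
  then show "v \<in> measurable M section_space"
    using borel_measurable_LIMSEQ_real[of M u v, OF lim] assms(1) by (auto simp: section_iff)
  have "AE \<theta> in M. \<forall>n. u n \<theta> \<in> \<Gamma> \<theta>" using assms(2) by (simp add: AE_all_countable)
  then show "AE \<theta> in M. v \<theta> \<in> \<Gamma> \<theta>" using AE_space
  proof eventually_elim
    case (elim \<theta>)
    show ?case by (rule closed_sequentially[OF _ _ lim[OF elim(2)]]) (use elim(1) in auto)
  qed
qed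

text \<open>The limit is clamped to \<open>{a..b}\<close> because a section must take its values there also on the
  exceptional set where the sequence diverges.\<close>

lemma section_limit_AE:
  assumes u: "\<And>n. u n \<in> measurable M section_space" "\<And>n. AE \<theta> in M. u n \<theta> \<in> \<Gamma> \<theta>"
    and conv: "AE \<theta> in M. convergent (\<lambda>n. u n \<theta>)"
  obtains v where "v \<in> measurable M section_space" "AE \<theta> in M. v \<theta> \<in> \<Gamma> \<theta>"
    "AE \<theta> in M. (\<lambda>n. u n \<theta>) \<longlonglongrightarrow> v \<theta>"
proof -
  define v where "v \<theta> = max a (min b (lim (\<lambda>n. u n \<theta>)))" for \<theta>
  have [measurable]: "u n \<in> borel_measurable M" for n using u(1) by (simp add: section_iff)
  have "v \<in> borel_measurable M" unfolding v_def[abs_def] by measurable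
  then have v: "v \<in> measurable M section_space" using ab by (simp add: section_iff v_def)
  have lim: "AE \<theta> in M. (\<lambda>n. u n \<theta>) \<longlonglongrightarrow> v \<theta>"
    using conv AE_space
  proof eventually_elim
    case (elim \<theta>)
    then have *: "(\<lambda>n. u n \<theta>) \<longlonglongrightarrow> lim (\<lambda>n. u n \<theta>)" by (simp add: convergent_LIMSEQ_iff)
    have "lim (\<lambda>n. u n \<theta>) \<in> {a..b}"
      by (rule closed_sequentially[OF _ _ *]) (use u(1) elim in \<open>auto simp: section_iff\<close>)
    then show ?case using * by (simp add: v_def)
  qed
  have "AE \<theta> in M. \<forall>n. u n \<theta> \<in> \<Gamma> \<theta>" using u(2) by (simp add: AE_all_countable)
  then have "AE \<theta> in M. v \<theta> \<in> \<Gamma> \<theta>" using lim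
  proof eventually_elim
    case (elim \<theta>)
    show ?case by (rule closed_sequentially[OF _ _ elim(2)]) (use elim(1) in auto)
  qed
  with v lim that show ?thesis by blast
qed

lemma AE_tendsto_image:
  assumes u: "\<And>n. u n \<in> measurable M section_space"
    and \<beta>: "\<And>n. \<beta> n \<in> {0..1}" "\<beta> \<longlonglongrightarrow> \<beta>'"
    and lim: "AE \<theta> in M. (\<lambda>n. u n \<theta>) \<longlonglongrightarrow> v \<theta>"
  shows "AE \<theta> in M. (\<lambda>n. f (\<beta> n) \<theta> (u n \<theta>)) \<longlonglongrightarrow> f \<beta>' \<theta> (v \<theta>)"
    and "AE \<theta> in M. (\<lambda>n. D (\<beta> n) \<theta> (u n \<theta>)) \<longlonglongrightarrow> D \<beta>' \<theta> (v \<theta>)"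
  using lim AE_space AE_regular
  by (eventually_elim; use fibre_tendsto[OF _ \<beta>] u in \<open>simp add: section_iff\<close>)+

lemma subinvariant_limit:
  assumes sub: "\<And>n. subinvariant \<beta> (u n)" and \<beta>: "\<beta> \<in> {0..1}"
    and lim: "\<And>\<theta>. \<theta> \<in> space M \<Longrightarrow> (\<lambda>n. u n \<theta>) \<longlonglongrightarrow> v \<theta>"
  shows "subinvariant \<beta> v"
proof -
  have u: "u n \<in> measurable M section_space" "AE \<theta> in M. u n \<theta> \<in> \<Gamma> \<theta>" for n
    using sub by (auto simp: subinvariant_def)
  have AE_lim: "AE \<theta> in M. (\<lambda>n. u n \<theta>) \<longlonglongrightarrow> v \<theta>" using lim by simp
  have "AE \<theta> in M. \<forall>n. f \<beta> \<theta> (u n \<theta>) \<le> u n (\<omega> \<theta>)"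
    using sub by (simp add: AE_all_countable subinvariant_def)
  then have "AE \<theta> in M. f \<beta> \<theta> (v \<theta>) \<le> v (\<omega> \<theta>)"
    using AE_tendsto_image(1)[OF u(1) \<beta> tendsto_const AE_lim] AE_\<omega>[OF AE_lim]
    by eventually_elim (blast intro: LIMSEQ_le)
  then show ?thesis using section_limit[of u v, OF u lim] by (simp add: subinvariant_def)
qed

lemma graph_limit:
  assumes graph: "\<And>n. graph (\<beta> n) (u n)" and \<beta>: "\<And>n. \<beta> n \<in> {0..1}" "\<beta> \<longlonglongrightarrow> \<beta>'"
    and conv: "AE \<theta> in M. convergent (\<lambda>n. u n \<theta>)"
  obtains v where "graph \<beta>' v" "AE \<theta> in M. (\<lambda>n. u n \<theta>) \<longlonglongrightarrow> v \<theta>"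
proof -
  have u: "u n \<in> measurable M section_space" "AE \<theta> in M. u n \<theta> \<in> \<Gamma> \<theta>" for n
    using graph by (auto simp: graph_iff)
  obtain v where v: "v \<in> measurable M section_space" "AE \<theta> in M. v \<theta> \<in> \<Gamma> \<theta>"
    and lim: "AE \<theta> in M. (\<lambda>n. u n \<theta>) \<longlonglongrightarrow> v \<theta>"
    using section_limit_AE[of u, OF u conv] by blast
  have "AE \<theta> in M. \<forall>n. f (\<beta> n) \<theta> (u n \<theta>) = u n (\<omega> \<theta>)"
    using graph by (simp add: AE_all_countable graph_iff)
  then have "AE \<theta> in M. f \<beta>' \<theta> (v \<theta>) = v (\<omega> \<theta>)"
    using AE_tendsto_image(1)[OF u(1) \<beta> lim] AE_\<omega>[OF lim]
    by eventually_elim (simp add: LIMSEQ_unique)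
  then have "graph \<beta>' v" using v by (simp add: graph_iff)
  then show ?thesis using lim that by blast
qed

lemma section_bound:
  assumes "\<psi> \<in> measurable M section_space" "\<theta> \<in> space M"
  shows "\<bar>\<psi> \<theta>\<bar> \<le> \<bar>a\<bar> + \<bar>b\<bar>"
  using assms by (force simp: section_iff)

text \<open>The greatest subinvariant section \<open>\<phi>\<close> is invariant. Raise it by \<open>exp (- \<eta>)\<close> times its defect
  \<open>\<phi> \<circ> \<omega> - f\<^sub>\<beta>(\<phi>)\<close>, cut off at \<open>\<gamma>\<^sup>+\<close>. As the slopes of the fibre maps are at most \<open>exp \<eta>\<close>, this
  raises \<open>f\<^sub>\<beta>(\<phi>)\<close> by no more than the defect, and the result is again subinvariant. By maximality
  nothing was gained: either the defect vanishes or \<open>\<phi>\<close> has reached \<open>\<gamma>\<^sup>+\<close>, where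
  \<open>f\<^sub>\<beta>(\<gamma>\<^sup>+) \<ge> \<gamma>\<^sup>+ \<circ> \<omega>\<close> rules out a positive defect.\<close>

lemma greatest_graph:
  assumes \<beta>: "\<beta> \<in> {0..1}" and "subinvariant \<beta> \<rho>"
  obtains \<phi> where "graph \<beta> \<phi>" "\<And>\<psi>. subinvariant \<beta> \<psi> \<Longrightarrow> AE \<theta> in M. \<psi> \<theta> \<le> \<phi> \<theta>"
proof -
  obtain \<phi> where "\<phi> \<in> Collect (subinvariant \<beta>)"
    and "\<And>\<psi>. \<psi> \<in> Collect (subinvariant \<beta>) \<Longrightarrow> AE \<theta> in M. \<psi> \<theta> \<le> \<phi> \<theta>"
  proof (rule ae_greatest_element)
    show "Collect (subinvariant \<beta>) \<noteq> {}" using assms by auto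
    show "u \<in> borel_measurable M" if "u \<in> Collect (subinvariant \<beta>)" for u
      using that by (auto simp: subinvariant_def section_iff)
    show "\<bar>u \<theta>\<bar> \<le> \<bar>a\<bar> + \<bar>b\<bar>" if "u \<in> Collect (subinvariant \<beta>)" "\<theta> \<in> space M" for u \<theta>
      using that section_bound by (auto simp: subinvariant_def)
    show "(\<lambda>\<theta>. max (u \<theta>) (v \<theta>)) \<in> Collect (subinvariant \<beta>)"
      if "u \<in> Collect (subinvariant \<beta>)" "v \<in> Collect (subinvariant \<beta>)" for u v
      using that subinvariant_max_min(1)[OF _ _ \<beta>] by simp
    show "v \<in> Collect (subinvariant \<beta>)" if "\<And>n. u n \<in> Collect (subinvariant \<beta>)"
      "\<And>\<theta>. \<theta> \<in> space M \<Longrightarrow> (\<lambda>n. u n \<theta>) \<longlonglongrightarrow> v \<theta>" for u v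
      using subinvariant_limit[of \<beta> u v] that \<beta> by simp
  qed blast
  then have \<phi>: "subinvariant \<beta> \<phi>" and max: "\<And>\<psi>. subinvariant \<beta> \<psi> \<Longrightarrow> AE \<theta> in M. \<psi> \<theta> \<le> \<phi> \<theta>"
    by auto
  then have [measurable]: "\<phi> \<in> borel_measurable M" and \<phi>_sec: "\<phi> \<in> measurable M section_space"
    and \<phi>\<Gamma>: "AE \<theta> in M. \<phi> \<theta> \<in> \<Gamma> \<theta>" and \<phi>_sub: "AE \<theta> in M. f \<beta> \<theta> (\<phi> \<theta>) \<le> \<phi> (\<omega> \<theta>)"
    by (auto simp: subinvariant_def section_iff)
  \<comment> \<open>The maximum with \<open>0\<close> is effective only on a null set; it keeps \<open>\<psi>\<close> above \<open>a\<close> there.\<close>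
  define \<psi> where "\<psi> \<theta> = min (\<gamma>p \<theta>) (\<phi> \<theta> + exp (- \<eta> \<theta>) * max 0 (\<phi> (\<omega> \<theta>) - f \<beta> \<theta> (\<phi> \<theta>)))" for \<theta>
  have [measurable]: "\<eta> \<in> borel_measurable M"
    unfolding \<eta>_def[abs_def] using \<eta>_int by (rule borel_measurable_integrable)
  have [measurable]: "\<gamma>p \<in> borel_measurable M" "(\<lambda>\<theta>. f \<beta> \<theta> (\<phi> \<theta>)) \<in> borel_measurable M"
    using \<gamma>p section_image_measurable[OF \<beta> \<phi>_sec] by (auto simp: section_iff)
  have "\<psi> \<in> borel_measurable M" unfolding \<psi>_def[abs_def] by measurable
  moreover have "\<psi> \<theta> \<in> {a..b}" if "\<theta> \<in> space M" for \<theta>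
    using \<phi>_sec \<gamma>_in(2)[OF that] that
    unfolding \<psi>_def by (auto simp: section_iff min_le_iff_disj intro: add_increasing2)
  ultimately have \<psi>_sec: "\<psi> \<in> measurable M section_space" by (simp add: section_iff)
  have "AE \<theta> in M. \<phi> \<theta> \<le> \<psi> \<theta> \<and> \<psi> \<theta> \<in> \<Gamma> \<theta>"
    using \<phi>\<Gamma> by eventually_elim (auto simp: \<psi>_def intro: add_increasing2)
  moreover from AE_\<omega>[OF this] this have "AE \<theta> in M. f \<beta> \<theta> (\<psi> \<theta>) \<le> \<psi> (\<omega> \<theta>)"
    using \<phi>\<Gamma> \<phi>_sub AE_regular
  proof eventually_elim
    case (elim \<theta>)
    then have le: "\<phi> \<theta> \<le> \<psi> \<theta>" "\<psi> \<theta> \<in> \<Gamma> \<theta>" by auto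
    have "f \<beta> \<theta> (\<psi> \<theta>) \<le> f \<beta> \<theta> (\<phi> \<theta>) + exp (\<eta> \<theta>) * (\<psi> \<theta> - \<phi> \<theta>)"
      using fibre_lipschitz[OF elim(5) \<beta> elim(3) le(2,1)] by simp
    also have "exp (\<eta> \<theta>) * (\<psi> \<theta> - \<phi> \<theta>)
        \<le> exp (\<eta> \<theta>) * (exp (- \<eta> \<theta>) * max 0 (\<phi> (\<omega> \<theta>) - f \<beta> \<theta> (\<phi> \<theta>)))"
      by (rule mult_left_mono) (auto simp: \<psi>_def)
    also have "\<dots> = \<phi> (\<omega> \<theta>) - f \<beta> \<theta> (\<phi> \<theta>)"
      using elim(4) by (simp add: mult.assoc[symmetric] exp_minus_inverse)
    finally show ?case using elim(1) by simp
  qed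
  ultimately have "subinvariant \<beta> \<psi>" using \<psi>_sec by (auto simp: subinvariant_def elim: AE_mp)
  from max[OF this] have "AE \<theta> in M. f \<beta> \<theta> (\<phi> \<theta>) = \<phi> (\<omega> \<theta>)"
    using \<phi>\<Gamma> AE_\<omega>[OF \<phi>\<Gamma>] \<phi>_sub AE_regular
  proof eventually_elim
    case (elim \<theta>)
    show ?case
    proof (cases "\<gamma>p \<theta> \<le> \<phi> \<theta>")
      case True
      then have "\<phi> \<theta> = \<gamma>p \<theta>" using elim by simp
      then show ?thesis using regularD(5)[OF elim(5) \<beta>] elim by auto
    next
      case False
      with elim(1) have "exp (- \<eta> \<theta>) * max 0 (\<phi> (\<omega> \<theta>) - f \<beta> \<theta> (\<phi> \<theta>)) \<le> 0"
        by (auto simp: \<psi>_def min_le_iff_disj)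
      then show ?thesis using elim(4) by (auto simp: mult_le_0_iff)
    qed
  qed
  then have "graph \<beta> \<phi>" using \<phi>_sec \<phi>\<Gamma> by (simp add: graph_iff)
  then show ?thesis using that max by blast
qed

text \<open>The graph transform maps a subinvariant section to a smaller one, which is again subinvariant by
  monotonicity of the fibre maps, and \<open>f\<^sub>\<beta>(\<gamma>\<^sup>-) \<ge> \<gamma>\<^sup>- \<circ> \<omega>\<close> keeps it inside \<open>\<Gamma>\<close>. Hence it fixes the
  least one.\<close>

lemma least_graph:
  assumes \<beta>: "\<beta> \<in> {0..1}" and "subinvariant \<beta> \<rho>"
  obtains \<phi> where "graph \<beta> \<phi>" "\<And>\<psi>. subinvariant \<beta> \<psi> \<Longrightarrow> AE \<theta> in M. \<phi> \<theta> \<le> \<psi> \<theta>"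
proof -
  let ?S = "{u. subinvariant \<beta> (\<lambda>\<theta>. - u \<theta>)}"
  obtain m where m: "m \<in> ?S" "\<And>u. u \<in> ?S \<Longrightarrow> AE \<theta> in M. u \<theta> \<le> m \<theta>"
  proof (rule ae_greatest_element)
    have "(\<lambda>\<theta>. - \<rho> \<theta>) \<in> ?S" using assms by simp
    then show "?S \<noteq> {}" by (rule ex_in_conv[THEN iffD1, OF exI])
    show "u \<in> borel_measurable M" if "u \<in> ?S" for u
      using that by (simp add: subinvariant_def section_iff)
    show "\<bar>u \<theta>\<bar> \<le> \<bar>a\<bar> + \<bar>b\<bar>" if "u \<in> ?S" "\<theta> \<in> space M" for u \<theta>
      using that section_bound[of "\<lambda>\<theta>. - u \<theta>" \<theta>] by (auto simp: subinvariant_def)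
    show "(\<lambda>\<theta>. max (u \<theta>) (v \<theta>)) \<in> ?S" if "u \<in> ?S" "v \<in> ?S" for u v
      using that subinvariant_max_min(2)[OF _ _ \<beta>] by (simp add: minus_max_eq_min)
    show "v \<in> ?S" if "\<And>n. u n \<in> ?S" "\<And>\<theta>. \<theta> \<in> space M \<Longrightarrow> (\<lambda>n. u n \<theta>) \<longlonglongrightarrow> v \<theta>" for u v
      using subinvariant_limit[of \<beta> "\<lambda>n \<theta>. - u n \<theta>" "\<lambda>\<theta>. - v \<theta>"] that \<beta>
      by (simp add: tendsto_minus)
  qed blast
  define \<phi> where "\<phi> \<theta> = - m \<theta>" for \<theta>
  have \<phi>: "subinvariant \<beta> \<phi>" using m(1) by (simp add: \<phi>_def[abs_def])
  have min: "AE \<theta> in M. \<phi> \<theta> \<le> \<psi> \<theta>" if "subinvariant \<beta> \<psi>" for \<psi>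
    using m(2)[of "\<lambda>\<theta>. - \<psi> \<theta>"] that by (auto simp: \<phi>_def elim!: AE_mp)
  have \<phi>_sec: "\<phi> \<in> measurable M section_space"
    and \<phi>\<Gamma>: "AE \<theta> in M. \<phi> \<theta> \<in> \<Gamma> \<theta>" and \<phi>_sub: "AE \<theta> in M. f \<beta> \<theta> (\<phi> \<theta>) \<le> \<phi> (\<omega> \<theta>)"
    using \<phi> by (auto simp: subinvariant_def)
  define \<psi> where "\<psi> \<theta> = f \<beta> (\<omega>_inv \<theta>) (\<phi> (\<omega>_inv \<theta>))" for \<theta>
  have \<psi>_sec: "\<psi> \<in> measurable M section_space" unfolding \<psi>_def
    by (rule measurable_compose[OF \<omega>_inv_measurable section_image_measurable[OF \<beta> \<phi>_sec]])
  have \<psi>_\<omega>: "AE \<theta> in M. \<psi> (\<omega> \<theta>) = f \<beta> \<theta> (\<phi> \<theta>)"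
    using AE_space by eventually_elim (simp add: \<psi>_def \<omega>_inv_\<omega>)
  have "AE \<theta> in M. \<psi> (\<omega> \<theta>) \<in> \<Gamma> (\<omega> \<theta>) \<and> \<psi> (\<omega> \<theta>) \<le> \<phi> (\<omega> \<theta>)"
    using \<psi>_\<omega> \<phi>\<Gamma> AE_\<omega>[OF \<phi>\<Gamma>] \<phi>_sub AE_regular
  proof eventually_elim
    case (elim \<theta>)
    have "f \<beta> \<theta> (\<gamma>m \<theta>) \<le> f \<beta> \<theta> (\<phi> \<theta>)"
      using fibre_le_iff[OF elim(5) \<beta>, of "\<gamma>m \<theta>" "\<phi> \<theta>"] elim(2) regularD(2)[OF elim(5)] by auto
    then show ?case using elim regularD(4)[OF elim(5) \<beta>] by auto
  qed
  then have *: "AE \<theta> in M. \<psi> \<theta> \<in> \<Gamma> \<theta> \<and> \<psi> \<theta> \<le> \<phi> \<theta>" by (rule AE_\<omega>_cancel)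
  then have "AE \<theta> in M. f \<beta> \<theta> (\<psi> \<theta>) \<le> \<psi> (\<omega> \<theta>)"
    using \<psi>_\<omega> \<phi>\<Gamma> AE_regular by eventually_elim (simp add: fibre_le_iff[OF _ \<beta>])
  with * \<psi>_sec have "subinvariant \<beta> \<psi>" by (auto simp: subinvariant_def elim: AE_mp)
  from AE_\<omega>[OF min[OF this]] \<psi>_\<omega> \<phi>_sub have "AE \<theta> in M. f \<beta> \<theta> (\<phi> \<theta>) = \<phi> (\<omega> \<theta>)"
    by eventually_elim simp
  then have "graph \<beta> \<phi>" using \<phi>_sec \<phi>\<Gamma> by (simp add: graph_iff)
  then show ?thesis using that min by blast
qed

section \<open>Signs of Lyapunov exponents\<close>

lemma ln_deriv_integrable:
  assumes \<beta>: "\<beta> \<in> {0..1}" and \<phi>: "\<phi> \<in> measurable M section_space" "AE \<theta> in M. \<phi> \<theta> \<in> \<Gamma> \<theta>"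
    and A: "A \<in> sets M"
  shows "integrable M (\<lambda>\<theta>. indicator A \<theta> * ln (D \<beta> \<theta> (\<phi> \<theta>)))"
    and "AE \<theta> in M. \<bar>indicator A \<theta> * ln (D \<beta> \<theta> (\<phi> \<theta>))\<bar> \<le> \<eta> \<theta>"
proof -
  note section_deriv_measurable[OF \<beta> \<phi>(1), measurable] A[measurable]
  show *: "AE \<theta> in M. \<bar>indicator A \<theta> * ln (D \<beta> \<theta> (\<phi> \<theta>))\<bar> \<le> \<eta> \<theta>"
    using \<phi>(2) AE_regular
  proof eventually_elim
    case (elim \<theta>)
    have "\<bar>ln (D \<beta> \<theta> (\<phi> \<theta>))\<bar> \<le> \<eta> \<theta>" by (rule abs_ln_deriv_le_\<eta>[OF elim(2) \<beta> elim(1)])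
    then show ?case by (auto simp: indicator_def)
  qed
  show "integrable M (\<lambda>\<theta>. indicator A \<theta> * ln (D \<beta> \<theta> (\<phi> \<theta>)))"
  proof (rule Bochner_Integration.integrable_bound)
    show "integrable M \<eta>" using \<eta>_int by (simp add: \<eta>_def[abs_def])
    show "AE \<theta> in M. norm (indicator A \<theta> * ln (D \<beta> \<theta> (\<phi> \<theta>))) \<le> norm (\<eta> \<theta>)"
      using * by eventually_elim auto
  qed measurable
qed

text \<open>By invariance the secant of \<open>f\<^sub>\<beta>\<close> from \<open>\<phi>(\<theta>)\<close> to \<open>\<psi>(\<theta>)\<close> has the slope
  \<open>(\<psi> - \<phi>)(\<omega> \<theta>) / (\<psi> - \<phi>)(\<theta>)\<close>, so its logarithm is a coboundary. Its integrability comes from the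
  mean value bounds, which place it between two functions dominated by \<open>\<eta>\<close>.\<close>

lemma integral_ln_secant:
  assumes \<beta>: "\<beta> \<in> {0..1}" and graphs: "graph \<beta> \<phi>" "graph \<beta> \<psi>"
    and A: "A \<in> sets M" "AE \<theta> in M. \<omega> \<theta> \<in> A \<longleftrightarrow> \<theta> \<in> A" "AE \<theta> in M. \<theta> \<in> A \<longrightarrow> \<phi> \<theta> < \<psi> \<theta>"
  defines "L \<equiv> \<lambda>\<theta>. indicator A \<theta> * ln ((f \<beta> \<theta> (\<psi> \<theta>) - f \<beta> \<theta> (\<phi> \<theta>)) / (\<psi> \<theta> - \<phi> \<theta>))"
  shows "integrable M L" "(\<integral>\<theta>. L \<theta> \<partial>M) = 0"
    and "AE \<theta> in M. indicator A \<theta> * ln (D \<beta> \<theta> (\<phi> \<theta>)) \<le> L \<theta> \<and> L \<theta> \<le> indicator A \<theta> * ln (D \<beta> \<theta> (\<psi> \<theta>))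
      \<and> (\<theta> \<in> A \<longrightarrow> ln (D \<beta> \<theta> (\<phi> \<theta>)) < L \<theta> \<and> L \<theta> < ln (D \<beta> \<theta> (\<psi> \<theta>)))"
proof -
  have sec: "\<phi> \<in> measurable M section_space" "\<psi> \<in> measurable M section_space"
    and in\<Gamma>: "AE \<theta> in M. \<phi> \<theta> \<in> \<Gamma> \<theta>" "AE \<theta> in M. \<psi> \<theta> \<in> \<Gamma> \<theta>"
    and inv: "AE \<theta> in M. f \<beta> \<theta> (\<phi> \<theta>) = \<phi> (\<omega> \<theta>)" "AE \<theta> in M. f \<beta> \<theta> (\<psi> \<theta>) = \<psi> (\<omega> \<theta>)"
    using graphs by (auto simp: graph_iff)
  have [measurable]: "\<phi> \<in> borel_measurable M" "\<psi> \<in> borel_measurable M"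
    "(\<lambda>\<theta>. f \<beta> \<theta> (\<phi> \<theta>)) \<in> borel_measurable M" "(\<lambda>\<theta>. f \<beta> \<theta> (\<psi> \<theta>)) \<in> borel_measurable M"
    using sec section_image_measurable[OF \<beta>] by (auto simp: section_iff)
  note A(1)[measurable]
  show bounds: "AE \<theta> in M. indicator A \<theta> * ln (D \<beta> \<theta> (\<phi> \<theta>)) \<le> L \<theta>
      \<and> L \<theta> \<le> indicator A \<theta> * ln (D \<beta> \<theta> (\<psi> \<theta>))
      \<and> (\<theta> \<in> A \<longrightarrow> ln (D \<beta> \<theta> (\<phi> \<theta>)) < L \<theta> \<and> L \<theta> < ln (D \<beta> \<theta> (\<psi> \<theta>)))"
    using in\<Gamma> A(3) AE_regular
  proof eventually_elim
    case (elim \<theta>)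
    show ?case
    proof (cases "\<theta> \<in> A")
      case True
      then have less: "\<phi> \<theta> < \<psi> \<theta>" using elim(3) by simp
      let ?s = "(f \<beta> \<theta> (\<psi> \<theta>) - f \<beta> \<theta> (\<phi> \<theta>)) / (\<psi> \<theta> - \<phi> \<theta>)"
      have s: "0 < D \<beta> \<theta> (\<phi> \<theta>)" "D \<beta> \<theta> (\<phi> \<theta>) < ?s" "?s < D \<beta> \<theta> (\<psi> \<theta>)"
        using secant_bounds[OF elim(4) \<beta> elim(1,2) less] regularD(6)[OF elim(4) \<beta> elim(1)] by auto
      from s(1,2) have "0 < ?s" by (rule less_trans)
      then have "ln (D \<beta> \<theta> (\<phi> \<theta>)) < ln ?s" "ln ?s < ln (D \<beta> \<theta> (\<psi> \<theta>))"
        using s by (auto simp del: zero_less_divide_iff)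
      then show ?thesis using True by (simp add: L_def)
    qed (simp add: L_def)
  qed
  show int: "integrable M L"
  proof (rule Bochner_Integration.integrable_bound)
    show "integrable M \<eta>" using \<eta>_int by (simp add: \<eta>_def[abs_def])
    show "L \<in> borel_measurable M" unfolding L_def by measurable
    show "AE \<theta> in M. norm (L \<theta>) \<le> norm (\<eta> \<theta>)"
      using bounds ln_deriv_integrable(2)[OF \<beta> sec(1) in\<Gamma>(1) A(1)]
        ln_deriv_integrable(2)[OF \<beta> sec(2) in\<Gamma>(2) A(1)]
      by eventually_elim auto
  qed
  define g where "g \<theta> = indicator A \<theta> * ln (\<psi> \<theta> - \<phi> \<theta>)" for \<theta>
  have g[measurable]: "g \<in> borel_measurable M" unfolding g_def[abs_def] by measurable
  have [measurable]: "L \<in> borel_measurable M" using int by simp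
  have L_eq: "AE \<theta> in M. L \<theta> = g (\<omega> \<theta>) - g \<theta>"
    using inv A(2,3) AE_\<omega>[OF A(3)]
  proof eventually_elim
    case (elim \<theta>)
    show ?case
    proof (cases "\<theta> \<in> A")
      case True
      then have "0 < \<psi> \<theta> - \<phi> \<theta>" "0 < \<psi> (\<omega> \<theta>) - \<phi> (\<omega> \<theta>)" using elim by auto
      then show ?thesis using True elim by (simp add: L_def g_def ln_div)
    qed (use elim in \<open>simp add: L_def g_def\<close>)
  qed
  have "integrable M (\<lambda>\<theta>. g (\<omega> \<theta>) - g \<theta>)"
    using int L_eq integrable_cong_AE[of L M "\<lambda>\<theta>. g (\<omega> \<theta>) - g \<theta>"] by simp
  then have "(\<integral>\<theta>. g (\<omega> \<theta>) - g \<theta> \<partial>M) = 0"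
    by (rule integral_coboundary[OF \<omega>_measurable \<omega>_distr g])
  moreover have "(\<integral>\<theta>. L \<theta> \<partial>M) = (\<integral>\<theta>. g (\<omega> \<theta>) - g \<theta> \<partial>M)"
    using L_eq by (intro integral_cong_AE) auto
  ultimately show "(\<integral>\<theta>. L \<theta> \<partial>M) = 0" by simp
qed

lemma integral_less_AE_on:
  fixes g h :: "'a \<Rightarrow> real"
  assumes int: "integrable M g" "integrable M h" and A: "A \<in> sets M"
    and le: "AE \<theta> in M. g \<theta> \<le> h \<theta>" and less: "AE \<theta> in M. \<theta> \<in> A \<longrightarrow> g \<theta> < h \<theta>" and "0 < prob A"
  shows "(\<integral>\<theta>. g \<theta> \<partial>M) < (\<integral>\<theta>. h \<theta> \<partial>M)"
proof -
  have "(\<integral>\<theta>. g \<theta> \<partial>M) \<noteq> (\<integral>\<theta>. h \<theta> \<partial>M)"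
  proof
    assume eq: "(\<integral>\<theta>. g \<theta> \<partial>M) = (\<integral>\<theta>. h \<theta> \<partial>M)"
    have "AE \<theta> in M. h \<theta> - g \<theta> = 0"
      using integral_nonneg_eq_0_iff_AE[of M "\<lambda>\<theta>. h \<theta> - g \<theta>"] int le eq by simp
    with less have "AE \<theta> in M. \<theta> \<notin> A" by eventually_elim auto
    then have "prob A = 0" using A by (simp add: prob_eq_0)
    then show False using assms by simp
  qed
  moreover have "(\<integral>\<theta>. g \<theta> \<partial>M) \<le> (\<integral>\<theta>. h \<theta> \<partial>M)" using int le by (rule integral_mono_AE)
  ultimately show ?thesis by simp
qed

text \<open>The set \<open>A\<close> localises the exponents: without ergodicity two graphs can agree over one invariant
  set and be ordered over another.\<close>

lemma exponent_signs:
  assumes \<beta>: "\<beta> \<in> {0..1}" and graphs: "graph \<beta> \<phi>" "graph \<beta> \<psi>"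
    and A: "A \<in> sets M" "AE \<theta> in M. \<omega> \<theta> \<in> A \<longleftrightarrow> \<theta> \<in> A" "AE \<theta> in M. \<theta> \<in> A \<longrightarrow> \<phi> \<theta> < \<psi> \<theta>"
  shows "(\<integral>\<theta>. indicator A \<theta> * ln (D \<beta> \<theta> (\<phi> \<theta>)) \<partial>M) \<le> 0"
    and "0 \<le> (\<integral>\<theta>. indicator A \<theta> * ln (D \<beta> \<theta> (\<psi> \<theta>)) \<partial>M)"
    and "0 < prob A \<Longrightarrow> (\<integral>\<theta>. indicator A \<theta> * ln (D \<beta> \<theta> (\<phi> \<theta>)) \<partial>M) < 0"
    and "0 < prob A \<Longrightarrow> 0 < (\<integral>\<theta>. indicator A \<theta> * ln (D \<beta> \<theta> (\<psi> \<theta>)) \<partial>M)"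
proof -
  note L = integral_ln_secant[OF assms]
  have int: "integrable M (\<lambda>\<theta>. indicator A \<theta> * ln (D \<beta> \<theta> (\<phi> \<theta>)))"
    "integrable M (\<lambda>\<theta>. indicator A \<theta> * ln (D \<beta> \<theta> (\<psi> \<theta>)))"
    using graphs ln_deriv_integrable(1)[OF \<beta> _ _ A(1)] by (simp_all add: graph_iff)
  show "(\<integral>\<theta>. indicator A \<theta> * ln (D \<beta> \<theta> (\<phi> \<theta>)) \<partial>M) \<le> 0"
    unfolding L(2)[symmetric] using L(3) by (intro integral_mono_AE int L(1)) (auto elim: AE_mp)
  show "0 \<le> (\<integral>\<theta>. indicator A \<theta> * ln (D \<beta> \<theta> (\<psi> \<theta>)) \<partial>M)"
    unfolding L(2)[symmetric] using L(3) by (intro integral_mono_AE int L(1)) (auto elim: AE_mp)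
  show "(\<integral>\<theta>. indicator A \<theta> * ln (D \<beta> \<theta> (\<phi> \<theta>)) \<partial>M) < 0" if "0 < prob A"
    unfolding L(2)[symmetric] using L(3)
    by (intro integral_less_AE_on[OF int(1) L(1) A(1) _ _ that]; eventually_elim) auto
  show "0 < (\<integral>\<theta>. indicator A \<theta> * ln (D \<beta> \<theta> (\<psi> \<theta>)) \<partial>M)" if "0 < prob A"
    unfolding L(2)[symmetric] using L(3)
    by (intro integral_less_AE_on[OF L(1) int(2) A(1) _ _ that]; eventually_elim) auto
qed

lemma graph_less_set:
  assumes \<beta>: "\<beta> \<in> {0..1}" and graphs: "graph \<beta> \<phi>" "graph \<beta> \<psi>"
  shows "{\<theta> \<in> space M. \<phi> \<theta> < \<psi> \<theta>} \<in> sets M"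
    and "AE \<theta> in M. \<phi> (\<omega> \<theta>) < \<psi> (\<omega> \<theta>) \<longleftrightarrow> \<phi> \<theta> < \<psi> \<theta>"
proof -
  have [measurable]: "\<phi> \<in> borel_measurable M" "\<psi> \<in> borel_measurable M"
    using graphs by (auto simp: graph_iff section_iff)
  show "{\<theta> \<in> space M. \<phi> \<theta> < \<psi> \<theta>} \<in> sets M" by measurable
  have "AE \<theta> in M. \<phi> \<theta> \<in> \<Gamma> \<theta>" "AE \<theta> in M. \<psi> \<theta> \<in> \<Gamma> \<theta>"
    "AE \<theta> in M. f \<beta> \<theta> (\<phi> \<theta>) = \<phi> (\<omega> \<theta>)" "AE \<theta> in M. f \<beta> \<theta> (\<psi> \<theta>) = \<psi> (\<omega> \<theta>)"
    using graphs by (auto simp: graph_iff)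
  then show "AE \<theta> in M. \<phi> (\<omega> \<theta>) < \<psi> (\<omega> \<theta>) \<longleftrightarrow> \<phi> \<theta> < \<psi> \<theta>"
    using AE_regular
  proof eventually_elim
    case (elim \<theta>)
    then show ?case using fibre_less_iff[OF elim(5) \<beta> elim(1,2)] by simp
  qed
qed

text \<open>Over the set where the inequalities are strict, the middle graph would have both a positive
  exponent, as the upper one of \<open>\<phi>, \<psi>\<close>, and a negative one, as the lower one of \<open>\<psi>, \<zeta>\<close>.\<close>

lemma sandwiched_graph:
  assumes \<beta>: "\<beta> \<in> {0..1}" and graphs: "graph \<beta> \<phi>" "graph \<beta> \<psi>" "graph \<beta> \<zeta>"
    and le: "AE \<theta> in M. \<phi> \<theta> \<le> \<psi> \<theta> \<and> \<psi> \<theta> \<le> \<zeta> \<theta>"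
  shows "AE \<theta> in M. \<psi> \<theta> = \<phi> \<theta> \<or> \<psi> \<theta> = \<zeta> \<theta>"
proof -
  let ?A = "{\<theta> \<in> space M. \<phi> \<theta> < \<psi> \<theta>} \<inter> {\<theta> \<in> space M. \<psi> \<theta> < \<zeta> \<theta>}"
  have A: "?A \<in> sets M" using graph_less_set(1)[OF \<beta>] graphs by blast
  have inv: "AE \<theta> in M. \<omega> \<theta> \<in> ?A \<longleftrightarrow> \<theta> \<in> ?A"
    using graph_less_set(2)[OF \<beta> graphs(1,2)] graph_less_set(2)[OF \<beta> graphs(2,3)]
      AE_space AE_\<omega>[OF AE_space]
    by eventually_elim auto
  have "\<not> 0 < prob ?A"
    using exponent_signs(3)[OF \<beta> graphs(2,3) A inv] exponent_signs(4)[OF \<beta> graphs(1,2) A inv] by auto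
  then have "prob ?A = 0" using measure_nonneg[of M ?A] by linarith
  then have "AE \<theta> in M. \<theta> \<notin> ?A" using A by (simp add: prob_eq_0)
  then show ?thesis using le AE_space by eventually_elim auto
qed

text \<open>The set of points that visit \<open>A\<close> infinitely often is strictly invariant, which is what the
  definition of ergodicity asks for; sets defined through invariant graphs are invariant only
  almost everywhere.\<close>

lemma invariant_set_representative:
  assumes A[measurable]: "A \<in> sets M" and inv: "AE \<theta> in M. \<omega> \<theta> \<in> A \<longleftrightarrow> \<theta> \<in> A"
  obtains B where "B \<in> sets M" "\<omega> -` B \<inter> space M = B" "AE \<theta> in M. \<theta> \<in> B \<longleftrightarrow> \<theta> \<in> A"
proof -
  have [measurable]: "(\<omega> ^^ n) \<in> measurable M M" for n
    by (induction n) (simp_all add: measurable_comp)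
  define B where "B = {\<theta> \<in> space M. \<forall>m. \<exists>n\<ge>m. (\<omega> ^^ n) \<theta> \<in> A}"
  have "B \<in> sets M" unfolding B_def by measurable
  moreover have "\<omega> -` B \<inter> space M = B"
  proof -
    have io_Suc: "(\<forall>m. \<exists>n\<ge>m. P (Suc n)) \<longleftrightarrow> (\<forall>m. \<exists>n\<ge>m. P n)" for P :: "nat \<Rightarrow> bool"
    proof (intro iffI allI)
      fix m assume "\<forall>m. \<exists>n\<ge>m. P (Suc n)"
      then obtain n where "n \<ge> m" "P (Suc n)" by blast
      then show "\<exists>n\<ge>m. P n" by (intro exI[of _ "Suc n"]) simp
    next
      fix m assume "\<forall>m. \<exists>n\<ge>m. P n"
      then obtain n where "n \<ge> Suc m" "P n" by blast
      then show "\<exists>n\<ge>m. P (Suc n)" by (intro exI[of _ "n - 1"]) simp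
    qed
    have "(\<forall>m. \<exists>n\<ge>m. (\<omega> ^^ n) (\<omega> \<theta>) \<in> A) \<longleftrightarrow> (\<forall>m. \<exists>n\<ge>m. (\<omega> ^^ n) \<theta> \<in> A)" for \<theta>
      using io_Suc[of "\<lambda>n. (\<omega> ^^ n) \<theta> \<in> A"] by (simp add: funpow_swap1)
    then show ?thesis using measurable_space[OF \<omega>_measurable] by (auto simp: B_def)
  qed
  moreover have "AE \<theta> in M. \<theta> \<in> B \<longleftrightarrow> \<theta> \<in> A"
  proof -
    have "AE \<theta> in M. (\<omega> ^^ n) \<theta> \<in> A \<longleftrightarrow> \<theta> \<in> A" for n
    proof (induction n)
      case (Suc n)
      from AE_\<omega>[OF Suc] inv show ?case by eventually_elim (simp add: funpow_swap1)
    qed simp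
    then have "AE \<theta> in M. \<forall>n. (\<omega> ^^ n) \<theta> \<in> A \<longleftrightarrow> \<theta> \<in> A" by (simp add: AE_all_countable)
    then show ?thesis using AE_space by eventually_elim (auto simp: B_def)
  qed
  ultimately show ?thesis using that by blast
qed

section \<open>The bifurcation\<close>

text \<open>A subinvariant section \<open>\<rho>\<close> for \<open>\<beta>'\<close> separates the extremal graphs for \<open>\<beta>\<close>: the lower one lies
  below \<open>\<rho>\<close>, and one application of \<open>f\<^sub>\<beta>\<close> pushes it below \<open>\<rho>\<close> by the margin
  \<open>c\<^sub>1 (\<beta>' - \<beta>)\<close>, whereas the upper one stays above \<open>\<rho>\<close>.\<close>

lemma extremal_graphs:
  assumes \<beta>: "0 \<le> \<beta>" "\<beta> \<le> \<beta>'" "\<beta>' \<le> 1" and "subinvariant \<beta>' \<rho>"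
  obtains \<phi>m \<phi>p where "graph \<beta> \<phi>m" "graph \<beta> \<phi>p"
    "\<And>\<psi>. subinvariant \<beta> \<psi> \<Longrightarrow> AE \<theta> in M. \<phi>m \<theta> \<le> \<psi> \<theta> \<and> \<psi> \<theta> \<le> \<phi>p \<theta>"
    "AE \<theta> in M. \<phi>m \<theta> + c1 * (\<beta>' - \<beta>) \<le> \<phi>p \<theta>"
proof -
  have \<beta>I: "\<beta> \<in> {0..1}" using \<beta> by simp
  note \<rho> = subinvariant_mono[OF assms(4) \<beta>]
  obtain \<phi>m where m: "graph \<beta> \<phi>m" "\<And>\<psi>. subinvariant \<beta> \<psi> \<Longrightarrow> AE \<theta> in M. \<phi>m \<theta> \<le> \<psi> \<theta>"
    using least_graph[OF \<beta>I \<rho>(2)] by blast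
  obtain \<phi>p where p: "graph \<beta> \<phi>p" "\<And>\<psi>. subinvariant \<beta> \<psi> \<Longrightarrow> AE \<theta> in M. \<psi> \<theta> \<le> \<phi>p \<theta>"
    using greatest_graph[OF \<beta>I \<rho>(2)] by blast
  have "AE \<theta> in M. \<phi>m \<theta> \<in> \<Gamma> \<theta>" "AE \<theta> in M. \<rho> \<theta> \<in> \<Gamma> \<theta>" "AE \<theta> in M. f \<beta> \<theta> (\<phi>m \<theta>) = \<phi>m (\<omega> \<theta>)"
    using m(1) \<rho>(2) by (auto simp: graph_iff subinvariant_def)
  then have "AE \<theta> in M. \<phi>m (\<omega> \<theta>) + c1 * (\<beta>' - \<beta>) \<le> \<rho> (\<omega> \<theta>)"
    using \<rho>(1) m(2)[OF \<rho>(2)] AE_regular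
  proof eventually_elim
    case (elim \<theta>)
    have "f \<beta> \<theta> (\<phi>m \<theta>) \<le> f \<beta> \<theta> (\<rho> \<theta>)" using fibre_le_iff[OF elim(6) \<beta>I elim(1,2)] elim(5) by simp
    then show ?case using elim(3,4) by linarith
  qed
  then have "AE \<theta> in M. \<phi>m \<theta> + c1 * (\<beta>' - \<beta>) \<le> \<rho> \<theta>" by (rule AE_\<omega>_cancel)
  with p(2)[OF \<rho>(2)] have sep: "AE \<theta> in M. \<phi>m \<theta> + c1 * (\<beta>' - \<beta>) \<le> \<phi>p \<theta>"
    by eventually_elim simp
  have "AE \<theta> in M. \<phi>m \<theta> \<le> \<psi> \<theta> \<and> \<psi> \<theta> \<le> \<phi>p \<theta>" if "subinvariant \<beta> \<psi>" for \<psi>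
    using m(2)[OF that] p(2)[OF that] by eventually_elim simp
  then show ?thesis using that m(1) p(1) sep by blast
qed

lemma subcritical:
  assumes \<beta>: "0 \<le> \<beta>" "\<beta> < \<beta>'" "\<beta>' \<le> 1" and sub: "subinvariant \<beta>' \<rho>"
  shows "\<exists>\<phi>m \<phi>p. exactly_two_graphs M \<omega> {a..b} (f \<beta>) \<Gamma> \<phi>m \<phi>p \<and>
           uniformly_separated M \<phi>m \<phi>p \<and>
           lyapunov M {a..b} (f \<beta>) \<phi>m < 0 \<and> lyapunov M {a..b} (f \<beta>) \<phi>p > 0"
proof -
  have \<beta>I: "\<beta> \<in> {0..1}" using \<beta> by simp
  obtain \<phi>m \<phi>p where graphs: "graph \<beta> \<phi>m" "graph \<beta> \<phi>p"
    and between: "\<And>\<psi>. subinvariant \<beta> \<psi> \<Longrightarrow> AE \<theta> in M. \<phi>m \<theta> \<le> \<psi> \<theta> \<and> \<psi> \<theta> \<le> \<phi>p \<theta>"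
    and sep: "AE \<theta> in M. \<phi>m \<theta> + c1 * (\<beta>' - \<beta>) \<le> \<phi>p \<theta>"
    using extremal_graphs[OF \<beta>(1) less_imp_le[OF \<beta>(2)] \<beta>(3) sub] by blast
  have [measurable]: "\<phi>m \<in> borel_measurable M" "\<phi>p \<in> borel_measurable M"
    using graphs by (auto simp: graph_iff section_iff)
  define \<epsilon> where "\<epsilon> = c1 * (\<beta>' - \<beta>)"
  have \<epsilon>: "0 < \<epsilon>" using c1 \<beta> by (simp add: \<epsilon>_def)
  have less: "AE \<theta> in M. \<phi>m \<theta> < \<phi>p \<theta>" using sep by eventually_elim (use \<epsilon> \<epsilon>_def in linarith)
  have two: "AE \<theta> in M. \<psi> \<theta> = \<phi>m \<theta> \<or> \<psi> \<theta> = \<phi>p \<theta>" if "graph \<beta> \<psi>" for \<psi>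
    by (rule sandwiched_graph[OF \<beta>I graphs(1) that graphs(2) between[OF graph_subinvariant[OF that]]])
  have dichotomy: "(AE \<theta> in M. \<psi> \<theta> = \<phi>m \<theta>) \<or> (AE \<theta> in M. \<psi> \<theta> = \<phi>p \<theta>)"
    if \<psi>: "graph \<beta> \<psi>" and erg: "ergodic M \<omega>" for \<psi>
  proof -
    let ?A = "{\<theta> \<in> space M. \<phi>m \<theta> < \<psi> \<theta>}"
    have A: "?A \<in> sets M" by (rule graph_less_set(1)[OF \<beta>I graphs(1) \<psi>])
    have inv: "AE \<theta> in M. \<omega> \<theta> \<in> ?A \<longleftrightarrow> \<theta> \<in> ?A"
      using graph_less_set(2)[OF \<beta>I graphs(1) \<psi>] AE_space AE_\<omega>[OF AE_space]
      by eventually_elim simp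
    obtain B where B: "B \<in> sets M" "\<omega> -` B \<inter> space M = B" "AE \<theta> in M. \<theta> \<in> B \<longleftrightarrow> \<theta> \<in> ?A"
      using invariant_set_representative[OF A inv] by blast
    then consider "AE \<theta> in M. \<theta> \<notin> B" | "AE \<theta> in M. \<theta> \<in> B"
      using erg by (auto simp: ergodic_def prob_eq_0 prob_eq_1)
    then show ?thesis
    proof cases
      case 1
      with B(3) two[OF \<psi>] less AE_space have "AE \<theta> in M. \<psi> \<theta> = \<phi>m \<theta>"
        by eventually_elim auto
      then show ?thesis ..
    next
      case 2
      with B(3) two[OF \<psi>] AE_space have "AE \<theta> in M. \<psi> \<theta> = \<phi>p \<theta>"
        by eventually_elim auto
      then show ?thesis ..
    qed
  qed
  have exact: "exactly_two_graphs M \<omega> {a..b} (f \<beta>) \<Gamma> \<phi>m \<phi>p"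
    unfolding exactly_two_graphs_def using graphs less two dichotomy by blast
  have "AE \<theta> in M. \<not> \<phi>p \<theta> - \<phi>m \<theta> < \<epsilon>" using sep by eventually_elim (simp add: \<epsilon>_def)
  then have "prob {\<theta> \<in> space M. \<phi>p \<theta> - \<phi>m \<theta> < \<epsilon>} = 0" by (subst prob_eq_0) auto
  then have sep': "uniformly_separated M \<phi>m \<phi>p"
    using less \<epsilon> unfolding uniformly_separated_def measurably_pinched_def
    by (auto elim: AE_mp intro!: exI[of _ \<epsilon>])
  have inv: "AE \<theta> in M. \<omega> \<theta> \<in> space M \<longleftrightarrow> \<theta> \<in> space M"
    using AE_space AE_\<omega>[OF AE_space] by eventually_elim simp
  have less': "AE \<theta> in M. \<theta> \<in> space M \<longrightarrow> \<phi>m \<theta> < \<phi>p \<theta>" using less by eventually_elim simp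
  have lyap: "lyapunov M {a..b} (f \<beta>) \<phi> = (\<integral>\<theta>. indicator (space M) \<theta> * ln (D \<beta> \<theta> (\<phi> \<theta>)) \<partial>M)" for \<phi>
    unfolding lyapunov_def by (rule Bochner_Integration.integral_cong) auto
  show ?thesis
    using exact sep' exponent_signs(3,4)[OF \<beta>I graphs sets.top inv less'] unfolding lyap
    by (auto simp: prob_space)
qed

text \<open>Let \<open>\<delta>\<close> be the separation. Strong convexity puts the image of the midpoint section at least
  \<open>\<kappa> = c\<^sub>2 \<delta>\<^sup>2 / 8\<close> below the midpoint section over the next fibre. Increasing the parameter by at most
  \<open>\<kappa> / C\<close> raises the image by no more than that.\<close>

lemma separated_persists:
  assumes \<beta>: "0 \<le> \<beta>" "\<beta> < 1" and graphs: "graph \<beta> \<phi>" "graph \<beta> \<psi>"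
    and sep: "uniformly_separated M \<phi> \<psi>"
  shows "\<exists>\<beta>' \<rho>. \<beta> < \<beta>' \<and> \<beta>' \<le> 1 \<and> subinvariant \<beta>' \<rho>"
proof -
  have \<beta>I: "\<beta> \<in> {0..1}" using \<beta> by simp
  have [measurable]: "\<phi> \<in> borel_measurable M" "\<psi> \<in> borel_measurable M"
    using graphs by (auto simp: graph_iff section_iff)
  obtain \<delta> where \<delta>: "\<delta> > 0" "\<not> prob {\<theta> \<in> space M. \<psi> \<theta> - \<phi> \<theta> < \<delta>} > 0"
    using sep unfolding uniformly_separated_def measurably_pinched_def by blast
  then have "prob {\<theta> \<in> space M. \<psi> \<theta> - \<phi> \<theta> < \<delta>} = 0"
    using measure_nonneg[of M "{\<theta> \<in> space M. \<psi> \<theta> - \<phi> \<theta> < \<delta>}"] by linarith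
  then have gap: "AE \<theta> in M. \<not> \<psi> \<theta> - \<phi> \<theta> < \<delta>" by (subst (asm) prob_eq_0) auto
  define \<kappa> where "\<kappa> = c2 / 8 * \<delta>\<^sup>2"
  have \<kappa>: "0 < \<kappa>" using c2 \<delta>(1) by (simp add: \<kappa>_def)
  have C: "0 < C" using c1 by simp
  define \<beta>' where "\<beta>' = min 1 (\<beta> + \<kappa> / C)"
  have \<beta>': "\<beta> < \<beta>'" "\<beta>' \<le> 1" using \<beta> \<kappa> C by (auto simp: \<beta>'_def)
  have "\<beta>' - \<beta> \<le> \<kappa> / C" by (simp add: \<beta>'_def)
  then have C_le: "C * (\<beta>' - \<beta>) \<le> \<kappa>" using C by (simp add: pos_le_divide_eq mult.commute)
  define \<rho> where "\<rho> \<theta> = (\<phi> \<theta> + \<psi> \<theta>) / 2" for \<theta>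
  have "\<rho> \<in> borel_measurable M" unfolding \<rho>_def[abs_def] by measurable
  moreover have "\<rho> \<theta> \<in> {a..b}" if "\<theta> \<in> space M" for \<theta>
    using graphs that by (force simp: graph_iff section_iff \<rho>_def)
  ultimately have \<rho>_sec: "\<rho> \<in> measurable M section_space" by (simp add: section_iff)
  have in\<Gamma>: "AE \<theta> in M. \<phi> \<theta> \<in> \<Gamma> \<theta>" "AE \<theta> in M. \<psi> \<theta> \<in> \<Gamma> \<theta>"
    and inv: "AE \<theta> in M. f \<beta> \<theta> (\<phi> \<theta>) = \<phi> (\<omega> \<theta>)" "AE \<theta> in M. f \<beta> \<theta> (\<psi> \<theta>) = \<psi> (\<omega> \<theta>)"
    using graphs by (auto simp: graph_iff)
  have \<rho>\<Gamma>: "AE \<theta> in M. \<rho> \<theta> \<in> \<Gamma> \<theta>" using in\<Gamma> by eventually_elim (auto simp: \<rho>_def)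
  have "AE \<theta> in M. f \<beta>' \<theta> (\<rho> \<theta>) \<le> \<rho> (\<omega> \<theta>)"
    using in\<Gamma> inv \<rho>\<Gamma> gap AE_regular
  proof eventually_elim
    case (elim \<theta>)
    have gap_\<theta>: "\<delta> \<le> \<psi> \<theta> - \<phi> \<theta>" and le: "\<phi> \<theta> \<le> \<psi> \<theta>" using elim(6) \<delta>(1) by auto
    have "f \<beta>' \<theta> (\<rho> \<theta>) \<le> f \<beta> \<theta> (\<rho> \<theta>) + C * (\<beta>' - \<beta>)"
      using fibre_parameter(2)[OF elim(7) \<beta>(1) less_imp_le[OF \<beta>'(1)] \<beta>'(2) elim(5)] by simp
    also have "f \<beta> \<theta> (\<rho> \<theta>) \<le> \<rho> (\<omega> \<theta>) - c2 / 8 * (\<psi> \<theta> - \<phi> \<theta>)\<^sup>2"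
      using fibre_midpoint[OF elim(7) \<beta>I elim(1,2) le] elim(3,4) by (simp add: \<rho>_def)
    finally have "f \<beta>' \<theta> (\<rho> \<theta>) \<le> \<rho> (\<omega> \<theta>) - c2 / 8 * (\<psi> \<theta> - \<phi> \<theta>)\<^sup>2 + C * (\<beta>' - \<beta>)" by simp
    moreover have "\<kappa> \<le> c2 / 8 * (\<psi> \<theta> - \<phi> \<theta>)\<^sup>2"
      unfolding \<kappa>_def using gap_\<theta> \<delta>(1) c2 by (intro mult_left_mono power_mono) auto
    ultimately show ?case using C_le by linarith
  qed
  with \<rho>_sec \<rho>\<Gamma> have "subinvariant \<beta>' \<rho>" by (simp add: subinvariant_def)
  with \<beta>' show ?thesis by blast
qed

lemma exponent_tendsto:
  assumes graph: "\<And>n. graph (\<beta> n) (u n)" and \<beta>: "\<And>n. \<beta> n \<in> {0..1}" "\<beta> \<longlonglongrightarrow> \<beta>'" "\<beta>' \<in> {0..1}"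
    and v: "graph \<beta>' v" "AE \<theta> in M. (\<lambda>n. u n \<theta>) \<longlonglongrightarrow> v \<theta>" and A: "A \<in> sets M"
  shows "(\<lambda>n. \<integral>\<theta>. indicator A \<theta> * ln (D (\<beta> n) \<theta> (u n \<theta>)) \<partial>M)
           \<longlonglongrightarrow> (\<integral>\<theta>. indicator A \<theta> * ln (D \<beta>' \<theta> (v \<theta>)) \<partial>M)"
proof (rule integral_dominated_convergence[where w = \<eta>])
  have u: "u n \<in> measurable M section_space" "AE \<theta> in M. u n \<theta> \<in> \<Gamma> \<theta>" for n
    using graph by (auto simp: graph_iff)
  have v': "v \<in> measurable M section_space" "AE \<theta> in M. v \<theta> \<in> \<Gamma> \<theta>"
    using v(1) by (auto simp: graph_iff)
  show "integrable M \<eta>" using \<eta>_int by (simp add: \<eta>_def[abs_def])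
  show "(\<lambda>\<theta>. indicator A \<theta> * ln (D (\<beta> n) \<theta> (u n \<theta>))) \<in> borel_measurable M" for n
    by (rule borel_measurable_integrable[OF ln_deriv_integrable(1)[OF \<beta>(1) u A]])
  show "(\<lambda>\<theta>. indicator A \<theta> * ln (D \<beta>' \<theta> (v \<theta>))) \<in> borel_measurable M"
    by (rule borel_measurable_integrable[OF ln_deriv_integrable(1)[OF \<beta>(3) v' A]])
  show "AE \<theta> in M. norm (indicator A \<theta> * ln (D (\<beta> n) \<theta> (u n \<theta>))) \<le> \<eta> \<theta>" for n
    using ln_deriv_integrable(2)[OF \<beta>(1) u A] by simp
  show "AE \<theta> in M. (\<lambda>n. indicator A \<theta> * ln (D (\<beta> n) \<theta> (u n \<theta>)))
      \<longlonglongrightarrow> indicator A \<theta> * ln (D \<beta>' \<theta> (v \<theta>))"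
    using AE_tendsto_image(2)[OF u(1) \<beta>(1,2) v(2)] v'(2) AE_regular
  proof eventually_elim
    case (elim \<theta>)
    have "D \<beta>' \<theta> (v \<theta>) \<noteq> 0" using regularD(6)[OF elim(3) \<beta>(3) elim(2)] by simp
    with elim(1) show ?case by (intro tendsto_intros)
  qed
qed

text \<open>The two graphs are the limits of the extremal graphs along parameters increasing to \<open>\<beta>\<^sub>c\<close>.
  Along the sequence the extremal graphs are strictly ordered almost everywhere, so the signs of
  their exponents hold over every invariant set, and they survive in the limit as weak inequalities, even where the limit
  graphs coincide.\<close>

lemma critical_graphs:
  assumes \<beta>c: "0 < \<beta>c" "\<beta>c \<le> 1"
    and below: "\<And>\<beta>. 0 \<le> \<beta> \<Longrightarrow> \<beta> < \<beta>c \<Longrightarrow> \<exists>\<rho>. subinvariant \<beta> \<rho>"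
  obtains \<phi>m \<phi>p where "graph \<beta>c \<phi>m" "graph \<beta>c \<phi>p"
    "\<And>\<psi>. subinvariant \<beta>c \<psi> \<Longrightarrow> AE \<theta> in M. \<phi>m \<theta> \<le> \<psi> \<theta> \<and> \<psi> \<theta> \<le> \<phi>p \<theta>"
    "\<And>A. A \<in> sets M \<Longrightarrow> AE \<theta> in M. \<omega> \<theta> \<in> A \<longleftrightarrow> \<theta> \<in> A \<Longrightarrow>
       (\<integral>\<theta>. indicator A \<theta> * ln (D \<beta>c \<theta> (\<phi>m \<theta>)) \<partial>M) \<le> 0 \<and>
       0 \<le> (\<integral>\<theta>. indicator A \<theta> * ln (D \<beta>c \<theta> (\<phi>p \<theta>)) \<partial>M)"
proof -
  define \<beta> where "\<beta> n = \<beta>c - \<beta>c / real (Suc n)" for n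
  have \<beta>_less: "\<beta> n < \<beta> (Suc n)" for n
    unfolding \<beta>_def using \<beta>c(1) by (intro diff_strict_left_mono divide_strict_left_mono) auto
  have \<beta>_bounds: "0 \<le> \<beta> n" "\<beta> n < \<beta>c" for n
    unfolding \<beta>_def using \<beta>c(1) by (simp_all add: divide_le_eq)
  have \<beta>I: "\<beta> n \<in> {0..1}" "\<beta>c \<in> {0..1}" for n using \<beta>_bounds[of n] \<beta>c by auto
  have \<beta>_lim: "\<beta> \<longlonglongrightarrow> \<beta>c" unfolding \<beta>_def by real_asymp
  \<comment> \<open>One relation for the pair, so that both sequences can be chosen at once.\<close>
  define extremal where "extremal n l u \<longleftrightarrow> graph (\<beta> n) l \<and> graph (\<beta> n) u \<and>
      (\<forall>\<psi>. subinvariant (\<beta> n) \<psi> \<longrightarrow> (AE \<theta> in M. l \<theta> \<le> \<psi> \<theta> \<and> \<psi> \<theta> \<le> u \<theta>)) \<and>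
      (AE \<theta> in M. l \<theta> < u \<theta>)" for n l u
  have "\<exists>l u. extremal n l u" for n
  proof -
    obtain \<rho> where \<rho>: "subinvariant (\<beta> (Suc n)) \<rho>" using below \<beta>_bounds by blast
    obtain \<phi>m \<phi>p where *: "graph (\<beta> n) \<phi>m" "graph (\<beta> n) \<phi>p"
      "\<And>\<psi>. subinvariant (\<beta> n) \<psi> \<Longrightarrow> AE \<theta> in M. \<phi>m \<theta> \<le> \<psi> \<theta> \<and> \<psi> \<theta> \<le> \<phi>p \<theta>"
      and sep: "AE \<theta> in M. \<phi>m \<theta> + c1 * (\<beta> (Suc n) - \<beta> n) \<le> \<phi>p \<theta>"
      using extremal_graphs[OF \<beta>_bounds(1) less_imp_le[OF \<beta>_less] _ \<rho>] \<beta>I(1)[of "Suc n"] by auto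
    have "0 < c1 * (\<beta> (Suc n) - \<beta> n)" using c1(1) \<beta>_less[of n] by simp
    with sep have "AE \<theta> in M. \<phi>m \<theta> < \<phi>p \<theta>" by (auto elim!: AE_mp)
    with * have "extremal n \<phi>m \<phi>p" by (simp add: extremal_def)
    then show ?thesis by blast
  qed
  then obtain l u where "\<And>n. extremal n (l n) (u n)" by metis
  then have l: "\<And>n. graph (\<beta> n) (l n)" and u: "\<And>n. graph (\<beta> n) (u n)"
    and between: "\<And>n \<psi>. subinvariant (\<beta> n) \<psi> \<Longrightarrow> AE \<theta> in M. l n \<theta> \<le> \<psi> \<theta> \<and> \<psi> \<theta> \<le> u n \<theta>"
    and less: "\<And>n. AE \<theta> in M. l n \<theta> < u n \<theta>"
    by (simp_all add: extremal_def)
  have "AE \<theta> in M. \<forall>n. l n \<theta> \<le> l (Suc n) \<theta>" "AE \<theta> in M. \<forall>n. u (Suc n) \<theta> \<le> u n \<theta>"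
  proof -
    have le: "\<beta> n \<le> \<beta> (Suc n)" "\<beta> (Suc n) \<le> 1" for n using \<beta>_less[of n] \<beta>I(1)[of "Suc n"] by auto
    have "subinvariant (\<beta> n) (l (Suc n))" "subinvariant (\<beta> n) (u (Suc n))" for n
      by (rule subinvariant_mono(2)[OF graph_subinvariant \<beta>_bounds(1) le], rule l u)+
    from between[OF this(1)] between[OF this(2)]
    show "AE \<theta> in M. \<forall>n. l n \<theta> \<le> l (Suc n) \<theta>" "AE \<theta> in M. \<forall>n. u (Suc n) \<theta> \<le> u n \<theta>"
      unfolding AE_all_countable by (auto elim: AE_mp)
  qed
  then have conv: "AE \<theta> in M. convergent (\<lambda>n. l n \<theta>)" "AE \<theta> in M. convergent (\<lambda>n. u n \<theta>)"
  proof -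
    have bounded: "\<bar>l n \<theta>\<bar> \<le> \<bar>a\<bar> + \<bar>b\<bar>" "\<bar>u n \<theta>\<bar> \<le> \<bar>a\<bar> + \<bar>b\<bar>" if "\<theta> \<in> space M" for n \<theta>
      using l[of n] u[of n] section_bound[OF _ that] by (auto simp: graph_iff)
    have conv: "convergent v" if "monoseq v" "\<And>n. \<bar>v n\<bar> \<le> \<bar>a\<bar> + \<bar>b\<bar>" for v :: "nat \<Rightarrow> real"
      using that by (intro Bseq_monoseq_convergent BseqI'[where K = "\<bar>a\<bar> + \<bar>b\<bar>"]) auto
    assume "AE \<theta> in M. \<forall>n. l n \<theta> \<le> l (Suc n) \<theta>"
    then show "AE \<theta> in M. convergent (\<lambda>n. l n \<theta>)" using AE_space
      by eventually_elim (auto intro!: conv bounded simp: monoseq_Suc)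
    assume "AE \<theta> in M. \<forall>n. u (Suc n) \<theta> \<le> u n \<theta>"
    then show "AE \<theta> in M. convergent (\<lambda>n. u n \<theta>)" using AE_space
      by eventually_elim (auto intro!: conv bounded simp: monoseq_Suc)
  qed
  obtain \<phi>m where m: "graph \<beta>c \<phi>m" "AE \<theta> in M. (\<lambda>n. l n \<theta>) \<longlonglongrightarrow> \<phi>m \<theta>"
    using graph_limit[OF l \<beta>I(1) \<beta>_lim conv(1)] by blast
  obtain \<phi>p where p: "graph \<beta>c \<phi>p" "AE \<theta> in M. (\<lambda>n. u n \<theta>) \<longlonglongrightarrow> \<phi>p \<theta>"
    using graph_limit[OF u \<beta>I(1) \<beta>_lim conv(2)] by blast
  have "AE \<theta> in M. \<phi>m \<theta> \<le> \<psi> \<theta> \<and> \<psi> \<theta> \<le> \<phi>p \<theta>" if "subinvariant \<beta>c \<psi>" for \<psi>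
  proof -
    have "subinvariant (\<beta> n) \<psi>" for n
      using subinvariant_mono(2)[OF that \<beta>_bounds(1) less_imp_le[OF \<beta>_bounds(2)] \<beta>c(2)] .
    then have "AE \<theta> in M. \<forall>n. l n \<theta> \<le> \<psi> \<theta> \<and> \<psi> \<theta> \<le> u n \<theta>"
      unfolding AE_all_countable using between by blast
    with m(2) p(2) show ?thesis
      by eventually_elim (blast intro: LIMSEQ_le_const LIMSEQ_le_const2)
  qed
  moreover have "(\<integral>\<theta>. indicator A \<theta> * ln (D \<beta>c \<theta> (\<phi>m \<theta>)) \<partial>M) \<le> 0 \<and>
       0 \<le> (\<integral>\<theta>. indicator A \<theta> * ln (D \<beta>c \<theta> (\<phi>p \<theta>)) \<partial>M)"
    if A: "A \<in> sets M" "AE \<theta> in M. \<omega> \<theta> \<in> A \<longleftrightarrow> \<theta> \<in> A" for A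
  proof -
    have "AE \<theta> in M. \<theta> \<in> A \<longrightarrow> l n \<theta> < u n \<theta>" for n using less[of n] by eventually_elim simp
    note signs = exponent_signs(1,2)[OF \<beta>I(1) l u A this]
    show ?thesis
      using LIMSEQ_le_const2[OF exponent_tendsto[OF l \<beta>I(1) \<beta>_lim \<beta>I(2) m A(1)], of 0]
        LIMSEQ_le_const[OF exponent_tendsto[OF u \<beta>I(1) \<beta>_lim \<beta>I(2) p A(1)], of 0] signs
      by blast
  qed
  ultimately show ?thesis using that m(1) p(1) by blast
qed

text \<open>Over the set \<open>B\<close> where the extremal graphs differ their exponents have strict signs, and over its
  complement they satisfy the weak inequalities of the limit. If \<open>B\<close> is a null set, the graph is unique
  and both weak inequalities apply to it.\<close>

lemma critical:
  assumes \<beta>c: "0 < \<beta>c" "\<beta>c < 1"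
    and below: "\<And>\<beta>. 0 \<le> \<beta> \<Longrightarrow> \<beta> < \<beta>c \<Longrightarrow> \<exists>\<rho>. subinvariant \<beta> \<rho>"
    and above: "\<And>\<beta> \<rho>. \<beta>c < \<beta> \<Longrightarrow> \<beta> \<le> 1 \<Longrightarrow> \<not> subinvariant \<beta> \<rho>"
  shows "(\<exists>\<phi>. exactly_one_graph M \<omega> {a..b} (f \<beta>c) \<Gamma> \<phi> \<and> lyapunov M {a..b} (f \<beta>c) \<phi> = 0) \<or>
     (\<exists>\<phi>m \<phi>p. graph \<beta>c \<phi>m \<and> graph \<beta>c \<phi>p \<and> \<not> (AE \<theta> in M. \<phi>m \<theta> = \<phi>p \<theta>) \<and>
               measurably_pinched M \<phi>m \<phi>p \<and>
               lyapunov M {a..b} (f \<beta>c) \<phi>m < 0 \<and> lyapunov M {a..b} (f \<beta>c) \<phi>p > 0)"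
proof -
  have \<beta>cI: "\<beta>c \<in> {0..1}" using \<beta>c by simp
  let ?I = "\<lambda>A \<phi>. \<integral>\<theta>. indicator A \<theta> * ln (D \<beta>c \<theta> (\<phi> \<theta>)) \<partial>M"
  obtain \<phi>m \<phi>p where graphs: "graph \<beta>c \<phi>m" "graph \<beta>c \<phi>p"
    and between: "\<And>\<psi>. subinvariant \<beta>c \<psi> \<Longrightarrow> AE \<theta> in M. \<phi>m \<theta> \<le> \<psi> \<theta> \<and> \<psi> \<theta> \<le> \<phi>p \<theta>"
    and weak: "\<And>A. A \<in> sets M \<Longrightarrow> AE \<theta> in M. \<omega> \<theta> \<in> A \<longleftrightarrow> \<theta> \<in> A \<Longrightarrow> ?I A \<phi>m \<le> 0 \<and> 0 \<le> ?I A \<phi>p"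
    by (rule critical_graphs[OF \<beta>c(1) less_imp_le[OF \<beta>c(2)] below]) auto
  have le: "AE \<theta> in M. \<phi>m \<theta> \<le> \<phi>p \<theta>"
    using between[OF graph_subinvariant[OF graphs(1)]] by eventually_elim simp
  define B where "B = {\<theta> \<in> space M. \<phi>m \<theta> < \<phi>p \<theta>}"
  have B: "B \<in> sets M" unfolding B_def by (rule graph_less_set(1)[OF \<beta>cI graphs])
  have B_inv: "AE \<theta> in M. \<omega> \<theta> \<in> B \<longleftrightarrow> \<theta> \<in> B"
    using graph_less_set(2)[OF \<beta>cI graphs] AE_space AE_\<omega>[OF AE_space]
    by eventually_elim (simp add: B_def)
  have E: "space M - B \<in> sets M" "AE \<theta> in M. \<omega> \<theta> \<in> space M - B \<longleftrightarrow> \<theta> \<in> space M - B"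
  proof -
    show "space M - B \<in> sets M" using B by simp
    show "AE \<theta> in M. \<omega> \<theta> \<in> space M - B \<longleftrightarrow> \<theta> \<in> space M - B"
      using B_inv AE_space AE_\<omega>[OF AE_space] by eventually_elim simp
  qed
  have lyap: "lyapunov M {a..b} (f \<beta>c) \<phi> = ?I B \<phi> + ?I (space M - B) \<phi>" if "graph \<beta>c \<phi>" for \<phi>
  proof -
    have \<phi>: "\<phi> \<in> measurable M section_space" "AE \<theta> in M. \<phi> \<theta> \<in> \<Gamma> \<theta>"
      using that by (auto simp: graph_iff)
    have "?I B \<phi> + ?I (space M - B) \<phi> = (\<integral>\<theta>. indicator B \<theta> * ln (D \<beta>c \<theta> (\<phi> \<theta>)) +
        indicator (space M - B) \<theta> * ln (D \<beta>c \<theta> (\<phi> \<theta>)) \<partial>M)"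
      by (intro Bochner_Integration.integral_add[symmetric] ln_deriv_integrable(1)[OF \<beta>cI \<phi>] B E)
    also have "\<dots> = lyapunov M {a..b} (f \<beta>c) \<phi>" unfolding lyapunov_def
      by (rule Bochner_Integration.integral_cong) (auto simp: indicator_def)
    finally show ?thesis by simp
  qed
  show ?thesis
  proof (cases "prob B = 0")
    case True
    then have "AE \<theta> in M. \<theta> \<notin> B" using B by (simp add: prob_eq_0)
    with le AE_space have eq: "AE \<theta> in M. \<phi>m \<theta> = \<phi>p \<theta>" by eventually_elim (auto simp: B_def)
    have "AE \<theta> in M. \<psi> \<theta> = \<phi>m \<theta>" if "graph \<beta>c \<psi>" for \<psi>
      using between[OF graph_subinvariant[OF that]] eq by eventually_elim simp
    then have one: "exactly_one_graph M \<omega> {a..b} (f \<beta>c) \<Gamma> \<phi>m"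
      using graphs(1) by (simp add: exactly_one_graph_def)
    have meas: "(\<lambda>\<theta>. D \<beta>c \<theta> (\<phi>m \<theta>)) \<in> borel_measurable M" "(\<lambda>\<theta>. D \<beta>c \<theta> (\<phi>p \<theta>)) \<in> borel_measurable M"
      using graphs section_deriv_measurable[OF \<beta>cI] by (auto simp: graph_iff)
    have "lyapunov M {a..b} (f \<beta>c) \<phi>m = lyapunov M {a..b} (f \<beta>c) \<phi>p"
      unfolding lyapunov_def
    proof (rule integral_cong_AE)
      show "AE \<theta> in M. ln (D \<beta>c \<theta> (\<phi>m \<theta>)) = ln (D \<beta>c \<theta> (\<phi>p \<theta>))"
        using eq by eventually_elim simp
    qed (use meas in measurable)
    then have "lyapunov M {a..b} (f \<beta>c) \<phi>m = 0"
      using lyap[OF graphs(1)] lyap[OF graphs(2)] weak[OF B B_inv] weak[OF E] by linarith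
    with one show ?thesis by blast
  next
    case False
    then have pos: "0 < prob B" using measure_nonneg[of M B] by linarith
    have B_less: "AE \<theta> in M. \<theta> \<in> B \<longrightarrow> \<phi>m \<theta> < \<phi>p \<theta>" by (simp add: B_def)
    note signs = exponent_signs(3,4)[OF \<beta>cI graphs B B_inv B_less pos]
    have "\<not> (AE \<theta> in M. \<phi>m \<theta> = \<phi>p \<theta>)"
    proof
      assume "AE \<theta> in M. \<phi>m \<theta> = \<phi>p \<theta>"
      then have "AE \<theta> in M. \<theta> \<notin> B" by eventually_elim (simp add: B_def)
      with False B show False by (simp add: prob_eq_0)
    qed
    moreover have "measurably_pinched M \<phi>m \<phi>p"
      using separated_persists[OF less_imp_le[OF \<beta>c(1)] \<beta>c(2) graphs] above le
      unfolding uniformly_separated_def by blast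
    moreover have "lyapunov M {a..b} (f \<beta>c) \<phi>m < 0" "lyapunov M {a..b} (f \<beta>c) \<phi>p > 0"
      using lyap[OF graphs(1)] lyap[OF graphs(2)] signs weak[OF E] by linarith+
    ultimately show ?thesis using graphs by blast
  qed
qed

text \<open>The critical parameter is the supremum of the parameters that admit a subinvariant section. It is
  the only one with these properties, as a parameter strictly between two such would both have and not have
  invariant graphs.\<close>

lemma saddle_node_bifurcation:
  assumes "graph 0 \<phi>1" "graph 0 \<phi>2" "uniformly_separated M \<phi>1 \<phi>2" "\<not> (\<exists>\<phi>. graph 1 \<phi>)"
  shows "\<exists>!\<beta>c. \<beta>c \<in> {0<..<1} \<and>
    (\<forall>\<beta>\<in>{0..1}. \<beta> < \<beta>c \<longrightarrow>
       (\<exists>\<phi>m \<phi>p. exactly_two_graphs M \<omega> {a..b} (f \<beta>) \<Gamma> \<phi>m \<phi>p \<and>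
                 uniformly_separated M \<phi>m \<phi>p \<and>
                 lyapunov M {a..b} (f \<beta>) \<phi>m < 0 \<and> lyapunov M {a..b} (f \<beta>) \<phi>p > 0)) \<and>
    ((\<exists>\<phi>. exactly_one_graph M \<omega> {a..b} (f \<beta>c) \<Gamma> \<phi> \<and> lyapunov M {a..b} (f \<beta>c) \<phi> = 0) \<or>
     (\<exists>\<phi>m \<phi>p. graph \<beta>c \<phi>m \<and> graph \<beta>c \<phi>p \<and> \<not> (AE \<theta> in M. \<phi>m \<theta> = \<phi>p \<theta>) \<and>
               measurably_pinched M \<phi>m \<phi>p \<and>
               lyapunov M {a..b} (f \<beta>c) \<phi>m < 0 \<and> lyapunov M {a..b} (f \<beta>c) \<phi>p > 0)) \<and>
    (\<forall>\<beta>\<in>{0..1}. \<beta> > \<beta>c \<longrightarrow> \<not> (\<exists>\<phi>. graph \<beta> \<phi>))" (is "\<exists>!\<beta>c. ?P \<beta>c")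
proof (rule ex_ex1I)
  define F where "F = {\<beta> \<in> {0..1}. \<exists>\<rho>. subinvariant \<beta> \<rho>}"
  define \<beta>c where "\<beta>c = Sup F"
  have F0: "0 \<in> F" using graph_subinvariant[OF assms(1)] by (auto simp: F_def)
  have bdd: "bdd_above F" by (rule bdd_aboveI[of _ 1]) (simp add: F_def)
  obtain \<beta>1 where \<beta>1: "0 < \<beta>1" "\<beta>1 \<in> F"
    using separated_persists[OF _ _ assms(1-3)] by (auto simp: F_def)
  have pos: "0 < \<beta>c" using cSup_upper[OF \<beta>1(2) bdd] \<beta>1(1) by (simp add: \<beta>c_def)
  have le1: "\<beta>c \<le> 1" unfolding \<beta>c_def
    by (rule cSup_least) (use F0 in blast, simp add: F_def)
  have below: "\<exists>\<rho>. subinvariant \<beta> \<rho>" if \<beta>: "0 \<le> \<beta>" "\<beta> < \<beta>c" for \<beta>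
  proof -
    have "\<exists>\<beta>'\<in>F. \<beta> < \<beta>'"
      using \<beta>(2) F0 less_cSup_iff[OF _ bdd] unfolding \<beta>c_def by blast
    then show ?thesis
      using subinvariant_mono(2)[OF _ \<beta>(1)] unfolding F_def by fastforce
  qed
  obtain \<rho> where \<rho>: "graph \<beta>c \<rho>" by (rule critical_graphs[OF pos le1 below])
  then have less1: "\<beta>c < 1" using assms(4) le1 by (cases "\<beta>c = 1") auto
  have above: "\<not> subinvariant \<beta> \<rho>" if "\<beta>c < \<beta>" "\<beta> \<le> 1" for \<beta> \<rho>
    using cSup_upper[OF _ bdd, of \<beta>] that pos unfolding \<beta>c_def[symmetric] by (force simp: F_def)
  show "\<exists>\<beta>c. ?P \<beta>c"
  proof (intro exI[of _ \<beta>c] conjI)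
    show "\<beta>c \<in> {0<..<1}" using pos less1 by simp
    show "\<forall>\<beta>\<in>{0..1}. \<beta> < \<beta>c \<longrightarrow>
       (\<exists>\<phi>m \<phi>p. exactly_two_graphs M \<omega> {a..b} (f \<beta>) \<Gamma> \<phi>m \<phi>p \<and>
                 uniformly_separated M \<phi>m \<phi>p \<and>
                 lyapunov M {a..b} (f \<beta>) \<phi>m < 0 \<and> lyapunov M {a..b} (f \<beta>) \<phi>p > 0)"
      using subcritical[OF _ _ le1 graph_subinvariant[OF \<rho>]] by simp
    show "\<forall>\<beta>\<in>{0..1}. \<beta> > \<beta>c \<longrightarrow> \<not> (\<exists>\<phi>. graph \<beta> \<phi>)"
      using above graph_subinvariant by (meson atLeastAtMost_iff)
  qed (rule critical[OF pos less1 below above])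
next
  fix \<beta>1 \<beta>2 assume P: "?P \<beta>1" "?P \<beta>2"
  have "\<not> \<beta> < \<beta>'" if "?P \<beta>" "?P \<beta>'" for \<beta> \<beta>'
  proof
    assume "\<beta> < \<beta>'"
    then obtain m where m: "\<beta> < m" "m < \<beta>'" using dense by blast
    moreover have "m \<in> {0..1}" using m that by simp
    ultimately have "\<exists>\<phi>. graph m \<phi>" "\<not> (\<exists>\<phi>. graph m \<phi>)"
      using that unfolding exactly_two_graphs_def by blast+
    then show False by blast
  qed
  from this[OF P] this[OF P(2,1)] show "\<beta>1 = \<beta>2" by linarith
qed

end

theorem theorem4p1:
  fixes M :: "'a measure" and \<omega> :: "'a \<Rightarrow> 'a"
    and a b :: real and X :: "real set"
    and f :: "real \<Rightarrow> 'a \<Rightarrow> real \<Rightarrow> real"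
    and \<gamma>m \<gamma>p :: "'a \<Rightarrow> real" and \<Gamma> :: "'a \<Rightarrow> real set"
  assumes mpds: "measure_preserving_system M \<omega>"
    and X: "a < b" "X = {a..b}"
    and family: "\<And>\<beta>. \<beta> \<in> {0..1} \<Longrightarrow> forced_C2_interval_map M \<omega> X (f \<beta>)"
    and \<gamma>m: "\<gamma>m \<in> measurable M (restrict_space borel X)"
    and \<gamma>p: "\<gamma>p \<in> measurable M (restrict_space borel X)"
    and \<gamma>_less: "AE \<theta> in M. \<gamma>m \<theta> < \<gamma>p \<theta>"
    and \<Gamma>: "\<And>\<theta>. \<Gamma> \<theta> = {\<gamma>m \<theta>..\<gamma>p \<theta>}"
    and r1: "\<exists>\<phi>1 \<phi>2. invariant_graph_in M \<omega> X (f 0) \<Gamma> \<phi>1 \<and>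
                     invariant_graph_in M \<omega> X (f 0) \<Gamma> \<phi>2 \<and>
                     uniformly_separated M \<phi>1 \<phi>2"
            "\<not> (\<exists>\<phi>. invariant_graph_in M \<omega> X (f 1) \<Gamma> \<phi>)"
    and r2: "AE \<theta> in M. \<forall>\<beta>\<in>{0..1}.
               f \<beta> \<theta> (\<gamma>m \<theta>) \<ge> \<gamma>m (\<omega> \<theta>) \<and> f \<beta> \<theta> (\<gamma>p \<theta>) \<ge> \<gamma>p (\<omega> \<theta>)"
    and r3: "AE \<theta> in M.
               continuous_on ({0..1} \<times> X) (\<lambda>(\<beta>, x). f \<beta> \<theta> x) \<and>
               continuous_on ({0..1} \<times> X) (\<lambda>(\<beta>, x). deriv_within X (f \<beta> \<theta>) x)"
    and r4: "integrable M
               (\<lambda>\<theta>. SUP (\<beta>, x)\<in>{0..1} \<times> \<Gamma> \<theta>. \<bar>ln (deriv_within X (f \<beta> \<theta>) x)\<bar>)"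
    and r5: "AE \<theta> in M. \<forall>\<beta>\<in>{0..1}. \<forall>x\<in>\<Gamma> \<theta>. deriv_within X (f \<beta> \<theta>) x > 0"
    and r6: "\<exists>c1 C. 0 < c1 \<and> c1 \<le> C \<and>
               (AE \<theta> in M. \<forall>\<beta>\<in>{0..1}. \<forall>x\<in>\<Gamma> \<theta>.
                  (\<lambda>s. f s \<theta> x) differentiable (at \<beta> within {0..1}) \<and>
                  c1 \<le> deriv_within {0..1} (\<lambda>s. f s \<theta> x) \<beta> \<and>
                  deriv_within {0..1} (\<lambda>s. f s \<theta> x) \<beta> \<le> C)"
    and r7: "\<exists>c2>0. AE \<theta> in M. \<forall>\<beta>\<in>{0..1}. \<forall>x\<in>\<Gamma> \<theta>.
               deriv_within X (deriv_within X (f \<beta> \<theta>)) x > c2"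
  shows "\<exists>!\<beta>c. \<beta>c \<in> {0<..<1} \<and>
    (\<forall>\<beta>\<in>{0..1}. \<beta> < \<beta>c \<longrightarrow>
       (\<exists>\<phi>m \<phi>p. exactly_two_graphs M \<omega> X (f \<beta>) \<Gamma> \<phi>m \<phi>p \<and>
                 uniformly_separated M \<phi>m \<phi>p \<and>
                 lyapunov M X (f \<beta>) \<phi>m < 0 \<and> lyapunov M X (f \<beta>) \<phi>p > 0)) \<and>
    ((\<exists>\<phi>. exactly_one_graph M \<omega> X (f \<beta>c) \<Gamma> \<phi> \<and> lyapunov M X (f \<beta>c) \<phi> = 0) \<or>
     (\<exists>\<phi>m \<phi>p. invariant_graph_in M \<omega> X (f \<beta>c) \<Gamma> \<phi>m \<and>
               invariant_graph_in M \<omega> X (f \<beta>c) \<Gamma> \<phi>p \<and>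
               \<not> (AE \<theta> in M. \<phi>m \<theta> = \<phi>p \<theta>) \<and>
               measurably_pinched M \<phi>m \<phi>p \<and>
               lyapunov M X (f \<beta>c) \<phi>m < 0 \<and> lyapunov M X (f \<beta>c) \<phi>p > 0)) \<and>
    (\<forall>\<beta>\<in>{0..1}. \<beta> > \<beta>c \<longrightarrow> \<not> (\<exists>\<phi>. invariant_graph_in M \<omega> X (f \<beta>) \<Gamma> \<phi>))"
proof -
  have \<Gamma>_eq: "\<Gamma> = (\<lambda>\<theta>. {\<gamma>m \<theta>..\<gamma>p \<theta>})" using \<Gamma> by (rule ext)
  obtain c1 C where c: "0 < c1" "c1 \<le> C"
    and c_AE: "AE \<theta> in M. \<forall>\<beta>\<in>{0..1}. \<forall>x\<in>\<Gamma> \<theta>.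
       (\<lambda>s. f s \<theta> x) differentiable (at \<beta> within {0..1}) \<and>
       c1 \<le> deriv_within {0..1} (\<lambda>s. f s \<theta> x) \<beta> \<and>
       deriv_within {0..1} (\<lambda>s. f s \<theta> x) \<beta> \<le> C"
    using r6 by blast
  obtain c2 where c2: "0 < c2" "AE \<theta> in M. \<forall>\<beta>\<in>{0..1}. \<forall>x\<in>\<Gamma> \<theta>.
       deriv_within X (deriv_within X (f \<beta> \<theta>)) x > c2"
    using r7 by blast
  interpret forced_convex_family M \<omega> a b f \<gamma>m \<gamma>p c1 C c2
    by unfold_locales
      (fact mpds X(1) c c2(1) family[unfolded X(2)] \<gamma>m[unfolded X(2)] \<gamma>p[unfolded X(2)] \<gamma>_less r2
        r3[unfolded X(2)] r4[unfolded X(2) \<Gamma>] r5[unfolded X(2) \<Gamma>] c_AE[unfolded \<Gamma>] c2(2)[unfolded X(2) \<Gamma>])+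
  from r1 show ?thesis unfolding X(2) \<Gamma>_eq using saddle_node_bifurcation by blast
qed

end
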